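(* Let $\{x^k\}$ be a sequence generated by the augmented Lagrangian method described in the context. Assume that $\{x^k\}_{k\in\mathcal{K}}$ converges to $x^\infty$ for some subsequence (infinite index set) $\mathcal{K}$. Then the following statements hold. (i) $x^\infty$ is a D-stationary point of the problem $$\min_{x\in X}\ \sum_{i=1}^I\left[\phi_i(x)+\zeta_i(x)-\psi_i(x)\right]_+^2 .$$ (ii) If $x^\infty\in\Omega$ and $\mathcal{I}_=(x^\infty)=\emptyset$, then $x^\infty$ is a D-stationary point of $\min_{x\in X}F(x)$. (iii) If $x^\infty\in\Omega$, $\mathcal{I}_=(x^\infty)\ne\emptyset$, and moreover the PSCQ holds for $\Omega$ at $x^\infty$, then $x^\infty$ is a B-stationary point of problem (P). (iv) Suppose that $\alpha>1$ in the augmented Lagrangian method. If $x^\infty\in\Omega$, $\mathcal{I}_=(x^\infty)\neq\emptyset$, $X$ is a polyhedral set, and moreover, for every $i\in\mathcal{I}_=(x^\infty)$ and $j_i\in\mathcal{J}_i(x^\infty)$, $\phi_i$ and $\psi_{i,j_i}$ are affine and $\zeta_i$ is piecewise affine on $X$, then $x^\infty$ is a B-stationary point of problem (P).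
   Context: Problem. Consider the DC program $$\text{(P)}\qquad \min_{x\in X}\ F(x)=\phi_0(x)+\zeta_0(x)-\psi_0(x)\quad\text{s.t.}\quad \phi_i(x)+\zeta_i(x)-\psi_i(x)\le 0,\ i=1,\dots,I,$$ where $\psi_i(x)=\max_{1\le j\le J_i}\psi_{i,j}(x)$ for $i=0,1,\dots,I$ and some integers $J_i$; $X\subseteq\mathbb{R}^n$ is closed and convex; the $\zeta_i$ are convex and continuous on an open set $\mathcal{S}\supseteq X$; the $\phi_i$ and $\psi_{i,j}$ are convex and continuously differentiable on $\mathcal{S}$; and $\|\nabla\phi_i(x)-\nabla\phi_i(y)\|\le L_i\|x-y\|$ for all $x,y\in X$, with $L_i\ge 0$ ($i=0,\dots,I$). It is assumed that $L_0>0$, and for $i\in\{1,\dots,I\}$ one takes $L_i=0$ if $\phi_i$ is affine. Notation. $\|\cdot\|$ is the Euclidean norm; $[a]_+=\max\{a,0\}$, $[a]_+^2=([a]_+)^2$. $\mathcal{I}=\{1,\dots,I\}$, $\mathcal{J}_i=\{1,\dots,J_i\}$, $\mathcal{J}=\mathcal{J}_1\times\cdots\times\mathcal{J}_I$, with elements $\mathbf{j}=(j_1,\dots,j_I)$. $\Omega$ is the feasible region of (P). For $x\in X$: $\mathcal{J}_i(x)=\{j\in\mathcal{J}_i:\psi_i(x)=\psi_{i,j}(x)\}$ for $i=0,\dots,I$; $\mathcal{J}(x)=\mathcal{J}_1(x)\times\cdots\times\mathcal{J}_I(x)$; $\mathcal{I}_=(x)=\{i\in\mathcal{I}:\phi_i(x)+\zeta_i(x)-\psi_i(x)=0\}$.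 For $\epsilon>0$: $\mathcal{J}_{0,\epsilon}(x)=\{j\in\mathcal{J}_0:\psi_0(x)\le\psi_{0,j}(x)+\epsilon\}$ and $\mathcal{J}_\epsilon(x)=\{(j_1,\dots,j_I)\in\mathcal{J}:\psi_i(x)\le\psi_{i,j_i}(x)+\epsilon\ \forall i\in\mathcal{I}\}$. Tangent cone: for $x\in Y\subseteq\mathbb{R}^n$, $\mathcal{T}_Y(x)$ is the set of $d=\lim_k (x^k-x)/\tau_k$ for some $x^k\in Y$, $x^k\to x$, $\tau_k\downarrow 0$. Directional derivative: $f'(x;d)=\lim_{\tau\downarrow0}(f(x+\tau d)-f(x))/\tau$. Stationarity. $x\in Y$ is a B-stationary point of $f$ on $Y$ (of the problem $\min_{x\in Y}f(x)$) if $f'(x;d)\ge0$ for all $d\in\mathcal{T}_Y(x)$. If $Y$ is closed and convex, $x\in Y$ is a D-stationary point of $f$ on $Y$ if $f'(x;\bar x-x)\ge0$ for all $\bar x\in Y$. A B-stationary point of (P) is a B-stationary point of $F$ on $\Omega$. PSCQ. For $\bar x\in\Omega$ with $\mathcal{I}_=(\bar x)\neq\emptyset$, the pointwise Slater constraint qualification (PSCQ) holds for $\Omega$ at $\bar x$ if for every $\mathbf{j}=(j_1,\dots,j_I)\in\mathcal{J}(\bar x)$ there is $d_{\mathbf{j}}\in\mathcal{T}_X(\bar x)$ with $\nabla\phi_i(\bar x)^Td_{\mathbf{j}}+\zeta_i'(\bar x;d_{\mathbf{j}})-\nabla\psi_{i,j_i}(\bar x)^Td_{\mathbf{j}}<0$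 for all $i\in\mathcal{I}_=(\bar x)$. Model functions. For $\bar x\in X$: $\ell_f(x;\bar x)=f(\bar x)+\nabla f(\bar x)^T(x-\bar x)$ for smooth $f$; $\hat\phi_i(x;\bar x)=\phi_i(\bar x)+\nabla\phi_i(\bar x)^T(x-\bar x)+\tfrac{L_i}{2}\|x-\bar x\|^2$. For $\rho>0$, $\lambda\in\mathbb{R}^I$, $j_0\in\mathcal{J}_0$, $\mathbf{j}=(j_1,\dots,j_I)\in\mathcal{J}$: $$\widetilde F_\rho(x,\lambda)=F(x)+\frac1{2\rho}\sum_{i=1}^I\left([\lambda_i+\rho(\phi_i(x)+\zeta_i(x)-\psi_i(x))]_+^2-\lambda_i^2\right),$$ $$\widetilde Q_\rho(x;\bar x,\lambda,j_0,\mathbf{j})=\hat\phi_0(x;\bar x)+\zeta_0(x)-\ell_{\psi_{0,j_0}}(x;\bar x)+\frac1{2\rho}\sum_{i=1}^I\left([\lambda_i+\rho(\hat\phi_i(x;\bar x)+\zeta_i(x)-\ell_{\psi_{i,j_i}}(x;\bar x))]_+^2-\lambda_i^2\right).$$ Augmented Lagrangian method. Input: $\epsilon>0$, $\rho_0>0$, $\alpha>0$, $\sigma>1$, $\lambda^0\in\mathbb{R}^I_+$, and a sequence $\{\eta_k\}$ of nonnegative reals with $\eta_k\to0$. For $k=0,1,2,\dots$: (1) find $x^k\in X$ such that $\widetilde F_{\rho_k}(x^k,\lambda^k)\le\widetilde Q_{\rho_k}(x;x^k,\lambda^k,j_0,\mathbf{j})+\eta_k$ for all $x\in X$, for every $j_0\in\mathcal{J}_{0,\epsilon}(x^k)$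 and every $\mathbf{j}\in\mathcal{J}_\epsilon(x^k)$; (2) set $\lambda_i^{k+1}=[\lambda_i^k+\rho_k(\phi_i(x^k)+\zeta_i(x^k)-\psi_i(x^k))]_+$ for $i=1,\dots,I$; (3) set $\rho_{k+1}=\max\{\sigma\rho_k,\|\lambda^{k+1}\|^{1+\alpha}\}$. *)

theory Defs
  imports "HOL-Analysis.Analysis"
begin

section \<open>Notions of variational analysis\<close>

definition grad :: "('a::euclidean_space \<Rightarrow> real) \<Rightarrow> 'a \<Rightarrow> 'a" where
  "grad f x = (THE v. GDERIV f x :> v)"

definition C1_on :: "'a::euclidean_space set \<Rightarrow> ('a \<Rightarrow> real) \<Rightarrow> bool" where
  "C1_on S f \<longleftrightarrow> (\<forall>x\<in>S. f differentiable (at x)) \<and> continuous_on S (grad f)"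

definition has_dir_deriv :: "('a::euclidean_space \<Rightarrow> real) \<Rightarrow> 'a \<Rightarrow> 'a \<Rightarrow> real \<Rightarrow> bool" where
  "has_dir_deriv f x d D \<longleftrightarrow> ((\<lambda>t. (f (x + t *\<^sub>R d) - f x) / t) \<longlongrightarrow> D) (at_right 0)"

definition dir_deriv :: "('a::euclidean_space \<Rightarrow> real) \<Rightarrow> 'a \<Rightarrow> 'a \<Rightarrow> real" where
  "dir_deriv f x d = (THE D. has_dir_deriv f x d D)"

definition tangent_cone :: "'a::euclidean_space set \<Rightarrow> 'a \<Rightarrow> 'a set" where
  "tangent_cone Y x =
     {d. \<exists>(y :: nat \<Rightarrow> 'a) (t :: nat \<Rightarrow> real).
           (\<forall>k. y k \<in> Y) \<and> y \<longlonglongrightarrow> x \<and> (\<forall>k. t k > 0) \<and> t \<longlonglongrightarrow> 0 \<and>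
           (\<lambda>k. (y k - x) /\<^sub>R t k) \<longlonglongrightarrow> d}"

text \<open>Both notions of stationarity include the existence of the directional derivatives, so
  that no junk value can satisfy the inequality. D-stationarity is meant for sets that are
  closed and convex.\<close>

definition B_stationary :: "('a::euclidean_space \<Rightarrow> real) \<Rightarrow> 'a set \<Rightarrow> 'a \<Rightarrow> bool" where
  "B_stationary f Y x \<longleftrightarrow>
     x \<in> Y \<and> (\<forall>d\<in>tangent_cone Y x. \<exists>D. has_dir_deriv f x d D \<and> D \<ge> 0)"

definition D_stationary :: "('a::euclidean_space \<Rightarrow> real) \<Rightarrow> 'a set \<Rightarrow> 'a \<Rightarrow> bool" where
  "D_stationary f Y x \<longleftrightarrow>
     x \<in> Y \<and> (\<forall>y\<in>Y. \<exists>D. has_dir_deriv f x (y - x) D \<and> D \<ge> 0)"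

definition affine_fun_on :: "'a::euclidean_space set \<Rightarrow> ('a \<Rightarrow> real) \<Rightarrow> bool" where
  "affine_fun_on A f \<longleftrightarrow> (\<exists>a b. \<forall>x\<in>A. f x = a \<bullet> x + b)"

definition piecewise_affine_on :: "'a::euclidean_space set \<Rightarrow> ('a \<Rightarrow> real) \<Rightarrow> bool" where
  "piecewise_affine_on A f \<longleftrightarrow>
     (\<exists>\<P>. finite \<P> \<and> A = \<Union>\<P> \<and> (\<forall>P\<in>\<P>. polyhedron P \<and> affine_fun_on P f))"


section \<open>The DC program\<close>

text \<open>The objective has index \<open>0\<close> and the constraints have indices \<open>1, \<dots>, ncon\<close>. The function
  \<open>\<psi>\<^sub>i\<close> is the maximum of the pieces \<open>psi_piece i j\<close> for \<open>j = 1, \<dots>, npiece i\<close>. The set \<open>X\<close> is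
  \<open>xset\<close>, and \<open>sdom\<close> is the open set containing it on which the functions live; their
  values outside \<open>sdom\<close> are irrelevant.\<close>

record 'a dc_program =
  ncon :: nat
  npiece :: "nat \<Rightarrow> nat"
  xset :: "'a set"
  sdom :: "'a set"
  phi :: "nat \<Rightarrow> 'a \<Rightarrow> real"
  zeta :: "nat \<Rightarrow> 'a \<Rightarrow> real"
  psi_piece :: "nat \<Rightarrow> nat \<Rightarrow> 'a \<Rightarrow> real"
  lip :: "nat \<Rightarrow> real"

text \<open>\<^const>\<open>convex_on\<close> entails that \<open>sdom\<close> is convex, and \<^const>\<open>lipschitz_on\<close> entails that
  the constants are nonnegative.\<close>

definition dc_assumptions :: "'a::euclidean_space dc_program \<Rightarrow> bool" where
  "dc_assumptions P \<longleftrightarrow>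
     closed (xset P) \<and> convex (xset P) \<and> open (sdom P) \<and> xset P \<subseteq> sdom P \<and>
     (\<forall>i\<in>{0..ncon P}.
        npiece P i \<ge> 1 \<and>
        convex_on (sdom P) (zeta P i) \<and> continuous_on (sdom P) (zeta P i) \<and>
        convex_on (sdom P) (phi P i) \<and> C1_on (sdom P) (phi P i) \<and>
        (\<forall>j\<in>{1..npiece P i}.
           convex_on (sdom P) (psi_piece P i j) \<and> C1_on (sdom P) (psi_piece P i j)) \<and>
        (lip P i)-lipschitz_on (xset P) (grad (phi P i))) \<and>
     lip P 0 > 0 \<and>
     (\<forall>i\<in>{1..ncon P}. affine_fun_on (sdom P) (phi P i) \<longrightarrow> lip P i = 0)"

definition psi :: "'a::euclidean_space dc_program \<Rightarrow> nat \<Rightarrow> 'a \<Rightarrow> real" where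
  "psi P i x = Max ((\<lambda>j. psi_piece P i j x) ` {1..npiece P i})"

definition dc_fun :: "'a::euclidean_space dc_program \<Rightarrow> nat \<Rightarrow> 'a \<Rightarrow> real" where
  "dc_fun P i x = phi P i x + zeta P i x - psi P i x"

abbreviation objective :: "'a::euclidean_space dc_program \<Rightarrow> 'a \<Rightarrow> real" where
  "objective P \<equiv> dc_fun P 0"

definition feasible_set :: "'a::euclidean_space dc_program \<Rightarrow> 'a set" where
  "feasible_set P = {x \<in> xset P. \<forall>i\<in>{1..ncon P}. dc_fun P i x \<le> 0}"

definition active_constraints :: "'a::euclidean_space dc_program \<Rightarrow> 'a \<Rightarrow> nat set" where
  "active_constraints P x = {i \<in> {1..ncon P}. dc_fun P i x = 0}"

definition active_pieces :: "'a::euclidean_space dc_program \<Rightarrow> nat \<Rightarrow> 'a \<Rightarrow> nat set" where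
  "active_pieces P i x = {j \<in> {1..npiece P i}. psi P i x = psi_piece P i j x}"

definition eps_active_pieces ::
    "'a::euclidean_space dc_program \<Rightarrow> real \<Rightarrow> nat \<Rightarrow> 'a \<Rightarrow> nat set" where
  "eps_active_pieces P \<epsilon> i x = {j \<in> {1..npiece P i}. psi P i x \<le> psi_piece P i j x + \<epsilon>}"

definition active_tuples :: "'a::euclidean_space dc_program \<Rightarrow> 'a \<Rightarrow> (nat \<Rightarrow> nat) set" where
  "active_tuples P x = (\<Pi>\<^sub>E i\<in>{1..ncon P}. active_pieces P i x)"

definition eps_active_tuples ::
    "'a::euclidean_space dc_program \<Rightarrow> real \<Rightarrow> 'a \<Rightarrow> (nat \<Rightarrow> nat) set" where
  "eps_active_tuples P \<epsilon> x = (\<Pi>\<^sub>E i\<in>{1..ncon P}. eps_active_pieces P \<epsilon> i x)"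

definition PSCQ :: "'a::euclidean_space dc_program \<Rightarrow> 'a \<Rightarrow> bool" where
  "PSCQ P x \<longleftrightarrow>
     (\<forall>j\<in>active_tuples P x. \<exists>d\<in>tangent_cone (xset P) x. \<forall>i\<in>active_constraints P x.
        grad (phi P i) x \<bullet> d + dir_deriv (zeta P i) x d - grad (psi_piece P i (j i)) x \<bullet> d < 0)"


section \<open>The augmented Lagrangian method\<close>

definition linearization :: "('a::euclidean_space \<Rightarrow> real) \<Rightarrow> 'a \<Rightarrow> 'a \<Rightarrow> real" where
  "linearization f x xb = f xb + grad f xb \<bullet> (x - xb)"

definition phi_hat :: "'a::euclidean_space dc_program \<Rightarrow> nat \<Rightarrow> 'a \<Rightarrow> 'a \<Rightarrow> real" where
  "phi_hat P i x xb = phi P i xb + grad (phi P i) xb \<bullet> (x - xb) + lip P i / 2 * (norm (x - xb))\<^sup>2"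

definition F_tilde ::
    "'a::euclidean_space dc_program \<Rightarrow> real \<Rightarrow> 'a \<Rightarrow> (nat \<Rightarrow> real) \<Rightarrow> real" where
  "F_tilde P \<rho> x l =
     objective P x
     + 1 / (2 * \<rho>) * (\<Sum>i=1..ncon P. (max (l i + \<rho> * dc_fun P i x) 0)\<^sup>2 - (l i)\<^sup>2)"

definition Q_tilde ::
    "'a::euclidean_space dc_program \<Rightarrow> real \<Rightarrow> 'a \<Rightarrow> 'a \<Rightarrow> (nat \<Rightarrow> real) \<Rightarrow> nat \<Rightarrow> (nat \<Rightarrow> nat) \<Rightarrow> real" where
  "Q_tilde P \<rho> x xb l j0 j =
     phi_hat P 0 x xb + zeta P 0 x - linearization (psi_piece P 0 j0) x xb
     + 1 / (2 * \<rho>) * (\<Sum>i=1..ncon P.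
         (max (l i + \<rho> * (phi_hat P i x xb + zeta P i x
                           - linearization (psi_piece P i (j i)) x xb)) 0)\<^sup>2 - (l i)\<^sup>2)"

text \<open>The iterates \<open>x k\<close>, multipliers \<open>l k\<close> and penalty parameters \<open>\<rho> k\<close> form a run of the method
  with inputs \<open>\<epsilon>\<close>, \<open>\<alpha>\<close>, \<open>\<sigma>\<close>, \<open>\<eta>\<close> and initial values \<open>\<rho> 0\<close>, \<open>l 0\<close>. Only the components
  \<open>l k i\<close> with \<open>1 \<le> i \<le> ncon P\<close> are meaningful.\<close>

definition alm_run ::
    "'a::euclidean_space dc_program \<Rightarrow> real \<Rightarrow> real \<Rightarrow> real \<Rightarrow> (nat \<Rightarrow> real) \<Rightarrow>
     (nat \<Rightarrow> 'a) \<Rightarrow> (nat \<Rightarrow> nat \<Rightarrow> real) \<Rightarrow> (nat \<Rightarrow> real) \<Rightarrow> bool" where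
  "alm_run P \<epsilon> \<alpha> \<sigma> \<eta> x l \<rho> \<longleftrightarrow>
     \<epsilon> > 0 \<and> \<rho> 0 > 0 \<and> \<alpha> > 0 \<and> \<sigma> > 1 \<and> (\<forall>i\<in>{1..ncon P}. l 0 i \<ge> 0) \<and>
     (\<forall>k. \<eta> k \<ge> 0) \<and> \<eta> \<longlonglongrightarrow> 0 \<and>
     (\<forall>k. x k \<in> xset P \<and>
          (\<forall>y\<in>xset P. \<forall>j0\<in>eps_active_pieces P \<epsilon> 0 (x k). \<forall>j\<in>eps_active_tuples P \<epsilon> (x k).
             F_tilde P (\<rho> k) (x k) (l k) \<le> Q_tilde P (\<rho> k) y (x k) (l k) j0 j + \<eta> k) \<and>
          (\<forall>i\<in>{1..ncon P}. l (Suc k) i = max (l k i + \<rho> k * dc_fun P i (x k)) 0) \<and>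
          \<rho> (Suc k) = max (\<sigma> * \<rho> k) (L2_set (l (Suc k)) {1..ncon P} powr (1 + \<alpha>)))"

end

theory Submission
  imports Defs
begin

text \<open>
  Each iterate almost minimizes, over \<open>X\<close>, a convex model of the augmented Lagrangian that is
  expanded at the iterate itself. The model of \<open>\<phi>\<^sub>i + \<zeta>\<^sub>i - \<psi>\<^sub>i\<close> keeps \<open>\<zeta>\<^sub>i\<close>, replaces \<open>\<phi>\<^sub>i\<close> by a
  quadratic and linearizes one piece of \<open>\<psi>\<^sub>i\<close>. All choices of almost active pieces are covered, and
  a piece that is active at the limit point \<open>x\<^sub>\<infinity>\<close> is almost active at late iterates. So the
  inequality passes to the limit for every choice of pieces active at \<open>x\<^sub>\<infinity>\<close>, in two ways.

  \<^item> Divided by \<open>\<rho>\<^sub>k\<close>, it says that \<open>x\<^sub>\<infinity>\<close> minimizes the model of the squared infeasibility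
    (\<open>limit_minimizes_penalty_model\<close>). This uses \<open>\<lambda>\<^sub>k / \<rho>\<^sub>k \<rightarrow> 0\<close>, a consequence of the update of
    \<open>\<rho>\<^sub>k\<close>.
  \<^item> Undivided, it says that the objective at \<open>x\<^sub>\<infinity>\<close> is at most the objective model at each \<open>y \<in> X\<close>
    whose penalty terms tend to zero (\<open>limit_minimizes_objective_model\<close>). They do so where all
    constraint models are negative, and also where a constraint model is merely nonpositive at all
    iterates, provided that \<open>\<lambda>\<^sub>k\<^sup>2 / \<rho>\<^sub>k \<rightarrow> 0\<close>, which holds for \<open>\<alpha> > 1\<close>.

  First-order conditions for the models carry over to the program: for each direction \<open>d\<close> there is an
  active piece whose model has the same directional derivative as the function
  (\<open>dc_fun_has_dir_deriv\<close>). This settles the two claims on D-stationarity, where \<open>d\<close> is a feasible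
  direction of \<open>X\<close>.

  For B-stationarity let \<open>d\<close> be tangent to the feasible set. Every active constraint has an active
  piece whose model has nonpositive slope along \<open>d\<close> (\<open>feasible_tangent_slope\<close>). Under the Slater
  condition for these pieces, adding a small multiple of a Slater direction makes the slopes
  negative; then the models are negative at nearby points of \<open>X\<close>, the objective model cannot
  decrease, and the multiple is sent to zero. In the affine case over a polyhedron, \<open>d\<close> itself is a
  feasible direction of \<open>X\<close>, and the models of the active constraints neither depend on the point of
  expansion nor become positive on a short segment along \<open>d\<close>.
\<close>

section \<open>Directional derivatives\<close>

lemma has_gradient_grad:
  assumes "C1_on S f" "x \<in> S"
  shows "(f has_derivative (\<lambda>h. grad f x \<bullet> h)) (at x)"
proof -
  obtain f' where f': "(f has_derivative f') (at x)"
    using assms by (auto simp: C1_on_def differentiable_def)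
  define v where "v = (\<Sum>b\<in>Basis. f' b *\<^sub>R b)"
  have "f' h = h \<bullet> v" for h
  proof -
    interpret linear f' using f' by (rule has_derivative_linear)
    have "f' h = f' (\<Sum>b\<in>Basis. (h \<bullet> b) *\<^sub>R b)" by (simp add: euclidean_representation)
    also have "\<dots> = (\<Sum>b\<in>Basis. (h \<bullet> b) * f' b)" by (simp add: sum scale)
    also have "\<dots> = h \<bullet> v" by (simp add: v_def inner_sum_right mult.commute)
    finally show ?thesis .
  qed
  then have v: "GDERIV f x :> v"
    using f' by (simp add: gderiv_def flip: \<open>\<And>h. f' h = h \<bullet> v\<close>)
  moreover have "w = v" if "GDERIV f x :> w" for w
  proof -
    have "(\<lambda>h. h \<bullet> w) = (\<lambda>h. h \<bullet> v)"
      using that v unfolding gderiv_def by (rule has_derivative_unique)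
    then have "h \<bullet> w = h \<bullet> v" for h by (rule fun_cong)
    then show ?thesis using vector_eq_ldot[of w v] by blast
  qed
  ultimately have "GDERIV f x :> grad f x"
    unfolding grad_def by (rule theI)
  then show ?thesis by (simp add: gderiv_def inner_commute)
qed

lemma grad_eqI:
  assumes "(f has_derivative (\<lambda>h. a \<bullet> h)) (at x)"
  shows "grad f x = a"
  unfolding grad_def
proof (rule the_equality)
  show a: "GDERIV f x :> a" using assms by (simp add: gderiv_def inner_commute)
  show "v = a" if "GDERIV f x :> v" for v
  proof -
    have "(\<lambda>h. h \<bullet> v) = (\<lambda>h. h \<bullet> a)"
      using that a unfolding gderiv_def by (rule has_derivative_unique)
    then have "h \<bullet> v = h \<bullet> a" for h by (rule fun_cong)
    then show ?thesis using vector_eq_ldot[of v a] by blast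
  qed
qed

lemma grad_affine:
  assumes "open S" "x \<in> S" "\<And>y. y \<in> S \<Longrightarrow> f y = a \<bullet> y + b"
  shows "grad f x = a"
proof (rule grad_eqI)
  have "((\<lambda>y. a \<bullet> y + b) has_derivative (\<lambda>h. a \<bullet> h)) (at x)"
    by (auto intro!: derivative_eq_intros)
  then show "(f has_derivative (\<lambda>h. a \<bullet> h)) (at x)"
    by (rule has_derivative_transform_within_open[OF _ assms(1,2)]) (simp add: assms(3))
qed

text \<open>A directional derivative is the one-sided derivative of the restriction to a ray, which
  gives access to the rules of one-variable calculus.\<close>

lemma has_dir_deriv_iff:
  "has_dir_deriv f x d D \<longleftrightarrow> ((\<lambda>t. f (x + t *\<^sub>R d)) has_real_derivative D) (at_right 0)"
  by (simp add: has_dir_deriv_def has_field_derivative_iff)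

lemma dir_deriv_eqI:
  assumes "has_dir_deriv f x d D"
  shows "dir_deriv f x d = D"
  unfolding dir_deriv_def
  using assms by (intro the_equality) (auto simp: has_dir_deriv_def intro: tendsto_unique[rotated])

lemma has_dir_deriv_add:
  "has_dir_deriv f x d D \<Longrightarrow> has_dir_deriv g x d E \<Longrightarrow> has_dir_deriv (\<lambda>y. f y + g y) x d (D + E)"
  by (auto simp: has_dir_deriv_iff intro: DERIV_add)

lemma has_dir_deriv_diff:
  "has_dir_deriv f x d D \<Longrightarrow> has_dir_deriv g x d E \<Longrightarrow> has_dir_deriv (\<lambda>y. f y - g y) x d (D - E)"
  by (auto simp: has_dir_deriv_iff intro: DERIV_diff)

lemma has_dir_deriv_sum:
  "(\<And>i. i \<in> A \<Longrightarrow> has_dir_deriv (f i) x d (D i)) \<Longrightarrow>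
   has_dir_deriv (\<lambda>y. \<Sum>i\<in>A. f i y) x d (\<Sum>i\<in>A. D i)"
  by (auto simp: has_dir_deriv_iff intro: DERIV_sum)

lemma has_dir_deriv_of_derivative:
  assumes "(f has_derivative f') (at x)"
  shows "has_dir_deriv f x d (f' d)"
proof -
  have "((\<lambda>t. x + t *\<^sub>R d) has_derivative (\<lambda>t. t *\<^sub>R d)) (at_right 0)"
    by (auto intro!: derivative_eq_intros)
  moreover have "(f has_derivative f') (at (x + 0 *\<^sub>R d))" using assms by simp
  ultimately have "((\<lambda>t. f (x + t *\<^sub>R d)) has_derivative (\<lambda>t. f' (t *\<^sub>R d))) (at_right 0)"
    by (rule has_derivative_compose)
  moreover have "f' (t *\<^sub>R d) = f' d * t" for t
    using has_derivative_linear[OF assms] by (simp add: linear_scale)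
  ultimately show ?thesis
    by (simp add: has_dir_deriv_iff has_field_derivative_def)
qed

lemma has_real_derivative_max_0_square:
  "((\<lambda>s. (max s 0)\<^sup>2) has_real_derivative 2 * max a 0) (at a)"
proof -
  consider "a > 0" | "a < 0" | "a = 0" by linarith
  then show ?thesis
  proof cases
    case 1
    have "((\<lambda>s. s\<^sup>2) has_real_derivative 2 * max a 0) (at a)"
      using 1 by (auto intro!: derivative_eq_intros)
    then show ?thesis
      by (rule has_field_derivative_transform_within_open[where S="{0<..}"]) (use 1 in auto)
  next
    case 2
    have "((\<lambda>s. 0) has_real_derivative 2 * max a 0) (at a)"
      using 2 by (auto intro!: derivative_eq_intros)
    then show ?thesis
      by (rule has_field_derivative_transform_within_open[where S="{..<0}"]) (use 2 in auto)
  next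
    case 3
    have "((\<lambda>s. (max s 0)\<^sup>2 / s) \<longlongrightarrow> (0::real)) (at 0)"
    proof (rule Lim_null_comparison)
      show "\<forall>\<^sub>F s in at 0. norm ((max s 0)\<^sup>2 / s) \<le> \<bar>s\<bar>"
        by (auto simp: max_def power2_eq_square)
      show "((\<lambda>s. \<bar>s\<bar>) \<longlongrightarrow> (0::real)) (at 0)"
        by (auto intro!: tendsto_eq_intros)
    qed
    then show ?thesis using 3 by (simp add: has_field_derivative_iff)
  qed
qed

lemma has_dir_deriv_max_0_square:
  assumes "has_dir_deriv g x d D"
  shows "has_dir_deriv (\<lambda>y. (max (g y) 0)\<^sup>2) x d (2 * max (g x) 0 * D)"
  using assms DERIV_chain'[of "\<lambda>t. g (x + t *\<^sub>R d)" D 0 "{0<..}" "\<lambda>s. (max s 0)\<^sup>2"]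
    has_real_derivative_max_0_square[of "g x"]
  by (simp add: has_dir_deriv_iff)

lemma has_dir_deriv_nonneg:
  assumes "has_dir_deriv f x d D" "\<forall>\<^sub>F t in at_right 0. f x \<le> f (x + t *\<^sub>R d)"
  shows "D \<ge> 0"
  using assms(1) unfolding has_dir_deriv_def
proof (rule tendsto_lowerbound)
  show "\<forall>\<^sub>F t in at_right 0. 0 \<le> (f (x + t *\<^sub>R d) - f x) / t"
    using assms(2) eventually_at_right_less[of 0] by eventually_elim simp
qed simp

lemma has_dir_deriv_eventually_less:
  assumes "has_dir_deriv f x d D" "D < 0"
  shows "\<forall>\<^sub>F t in at_right 0. f (x + t *\<^sub>R d) < f x"
proof -
  have "\<forall>\<^sub>F t in at_right 0. (f (x + t *\<^sub>R d) - f x) / t < 0"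
    using assms unfolding has_dir_deriv_def by (rule order_tendstoD)
  then show ?thesis
    using eventually_at_right_less[of 0] by eventually_elim (simp add: divide_less_0_iff)
qed

lemma tendsto_ray: "((\<lambda>t. x + t *\<^sub>R d) \<longlongrightarrow> x) (at_right (0::real))"
  for x d :: "'a::real_normed_vector"
  by (auto intro!: tendsto_eq_intros)

lemma has_dir_deriv_tendsto:
  assumes "has_dir_deriv f x d D"
  shows "((\<lambda>t. f (x + t *\<^sub>R d)) \<longlongrightarrow> f x) (at_right 0)"
  using has_field_derivative_imp_has_derivative[THEN has_derivative_continuous,
      OF assms[unfolded has_dir_deriv_iff]]
  by (simp add: continuous_within)

section \<open>Convex functions\<close>

text \<open>Along a ray the difference quotients of a convex function decrease as the step shrinks, and
  a single backward step bounds them from below.\<close>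

lemma convex_has_dir_deriv:
  fixes f :: "'a::euclidean_space \<Rightarrow> real"
  assumes S: "open S" and f: "convex_on S f" and x: "x \<in> S"
  shows "has_dir_deriv f x d (dir_deriv f x d)"
proof -
  define I where "I = (\<lambda>t::real. x + t *\<^sub>R d) -` S"
  define g where "g t = f (x + t *\<^sub>R d)" for t
  have "open I" unfolding I_def
    by (rule open_vimage[OF S]) (intro continuous_intros)
  have I0: "0 \<in> I" using x by (simp add: I_def)
  have comb: "x + (u * s + v * t) *\<^sub>R d = u *\<^sub>R (x + s *\<^sub>R d) + v *\<^sub>R (x + t *\<^sub>R d)"
    if "u + v = 1" for u v s t :: real
    using that by (simp add: algebra_simps flip: scaleR_left_distrib) 
  have g: "convex_on I g"
    using f unfolding convex_on_def convex_def I_def g_def by (auto simp: comb)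
  obtain e where e: "e > 0" "ball 0 e \<subseteq> I"
    using \<open>open I\<close> I0 openE by blast
  then have neg: "-(e/2) \<in> I" by (auto simp: dist_real_def)
  have "((\<lambda>t. (g t - g 0) / t) \<longlongrightarrow> Inf ((\<lambda>t. (g t - g 0) / t) ` ({0<..} \<inter> I)))
     (at 0 within ({0<..} \<inter> I))"
  proof (rule Lim_right_bound)
    fix a b assume "a \<in> I" "b \<in> I" "0 < a" "a \<le> b"
    then show "(g a - g 0) / a \<le> (g b - g 0) / b"
      using convex_on_slope_le(1)[OF g I0 \<open>b \<in> I\<close>, of a]
      by (cases "a = b") (auto simp: field_simps)
  next
    fix a assume a: "a \<in> I" "0 < a"
    have "(g (-(e/2)) - g 0) / (-(e/2) - 0) \<le> (g (-(e/2)) - g a) / (-(e/2) - a)"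
      by (rule convex_on_slope_le(1)[OF g neg a(1)]) (use e a in auto)
    also have "\<dots> \<le> (g 0 - g a) / (0 - a)"
      by (rule convex_on_slope_le(2)[OF g neg a(1)]) (use e a in auto)
    finally show "(g (-(e/2)) - g 0) / (-(e/2)) \<le> (g a - g 0) / a"
      using a by (simp add: field_simps)
  qed
  moreover have "at 0 within ({0<..} \<inter> I) = at_right 0"
    by (rule at_within_nhd[OF I0 \<open>open I\<close>]) auto
  ultimately have "\<exists>D. has_dir_deriv f x d D"
    unfolding has_dir_deriv_def g_def by auto
  then show ?thesis using dir_deriv_eqI by blast
qed

lemma convex_dir_deriv_lower_bound:
  fixes f :: "'a::euclidean_space \<Rightarrow> real"
  assumes S: "open S" and f: "convex_on S f" and x: "x \<in> S" and y: "y \<in> S"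
  shows "f x + dir_deriv f x (y - x) \<le> f y"
proof -
  have "dir_deriv f x (y - x) \<le> f y - f x"
    using convex_has_dir_deriv[OF S f x, of "y - x"] unfolding has_dir_deriv_def
  proof (rule tendsto_upperbound)
    have "\<forall>\<^sub>F t in at_right 0. t < (1::real)"
      by (rule order_tendstoD[OF tendsto_ident_at]) simp
    then show "\<forall>\<^sub>F t in at_right 0. (f (x + t *\<^sub>R (y - x)) - f x) / t \<le> f y - f x"
      using eventually_at_right_less[of 0]
    proof eventually_elim
      case (elim t)
      have "f ((1 - t) *\<^sub>R x + t *\<^sub>R y) \<le> (1 - t) * f x + t * f y"
        using convex_onD[OF f, of t x y] elim x y by simp
      moreover have "(1 - t) *\<^sub>R x + t *\<^sub>R y = x + t *\<^sub>R (y - x)" by (simp add: algebra_simps)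
      ultimately show ?case using elim by (simp add: field_simps)
    qed
  qed simp
  then show ?thesis by simp
qed

lemma dir_deriv_scale:
  fixes f :: "'a::euclidean_space \<Rightarrow> real"
  assumes S: "open S" and f: "convex_on S f" and x: "x \<in> S" and c: "c > 0"
  shows "dir_deriv f x (c *\<^sub>R d) = c * dir_deriv f x d"
proof (rule dir_deriv_eqI)
  have "filterlim (\<lambda>t. t * c) (at_right 0) (at_right (0::real))"
    using c by (auto simp: filterlim_at intro!: tendsto_eq_intros eventually_at_right_less
        eventually_mono[OF eventually_at_right_less[of 0]])
  then have "((\<lambda>t. (f (x + (t * c) *\<^sub>R d) - f x) / (t * c)) \<longlongrightarrow> dir_deriv f x d) (at_right 0)"
    using convex_has_dir_deriv[OF S f x, of d] unfolding has_dir_deriv_def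
    by (rule filterlim_compose[rotated])
  then have "((\<lambda>t. c * ((f (x + (t * c) *\<^sub>R d) - f x) / (t * c))) \<longlongrightarrow> c * dir_deriv f x d)
      (at_right 0)"
    by (intro tendsto_intros)
  then show "has_dir_deriv f x (c *\<^sub>R d) (c * dir_deriv f x d)"
    using c by (simp add: has_dir_deriv_def)
qed

lemma dir_deriv_convex:
  fixes f :: "'a::euclidean_space \<Rightarrow> real"
  assumes S: "open S" and f: "convex_on S f" and x: "x \<in> S"
    and uv: "u \<ge> 0" "v \<ge> 0" "u + v = 1"
  shows "dir_deriv f x (u *\<^sub>R d + v *\<^sub>R e) \<le> u * dir_deriv f x d + v * dir_deriv f x e"
proof (rule tendsto_le)
  let ?q = "\<lambda>d t. (f (x + t *\<^sub>R d) - f x) / t"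
  show "(?q (u *\<^sub>R d + v *\<^sub>R e) \<longlongrightarrow> dir_deriv f x (u *\<^sub>R d + v *\<^sub>R e)) (at_right 0)"
    using convex_has_dir_deriv[OF S f x] by (simp add: has_dir_deriv_def)
  show "((\<lambda>t. u * ?q d t + v * ?q e t) \<longlongrightarrow> u * dir_deriv f x d + v * dir_deriv f x e) (at_right 0)"
    using convex_has_dir_deriv[OF S f x] by (intro tendsto_intros) (auto simp: has_dir_deriv_def)
  have "\<forall>\<^sub>F t in at_right 0. x + t *\<^sub>R d \<in> S" "\<forall>\<^sub>F t in at_right 0. x + t *\<^sub>R e \<in> S"
    using topological_tendstoD[OF tendsto_ray S x] by blast+
  then show "\<forall>\<^sub>F t in at_right 0. ?q (u *\<^sub>R d + v *\<^sub>R e) t \<le> u * ?q d t + v * ?q e t"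
    using eventually_at_right_less[of 0]
  proof eventually_elim
    case (elim t)
    have eq: "x + t *\<^sub>R (u *\<^sub>R d + v *\<^sub>R e) = u *\<^sub>R (x + t *\<^sub>R d) + v *\<^sub>R (x + t *\<^sub>R e)"
      using uv(3) by (simp add: algebra_simps flip: scaleR_left_distrib)
    have "f (x + t *\<^sub>R (u *\<^sub>R d + v *\<^sub>R e)) \<le> u * f (x + t *\<^sub>R d) + v * f (x + t *\<^sub>R e)"
      unfolding eq using f elim uv by (auto simp: convex_on_def)
    then have "f (x + t *\<^sub>R (u *\<^sub>R d + v *\<^sub>R e)) - f x
        \<le> u * (f (x + t *\<^sub>R d) - f x) + v * (f (x + t *\<^sub>R e) - f x)"
      using uv(3) by (simp add: algebra_simps flip: distrib_right)
    then have "(f (x + t *\<^sub>R (u *\<^sub>R d + v *\<^sub>R e)) - f x) / t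
        \<le> (u * (f (x + t *\<^sub>R d) - f x) + v * (f (x + t *\<^sub>R e) - f x)) / t"
      using elim by (intro divide_right_mono) auto
    then show ?case by (simp add: add_divide_distrib)
  qed
qed simp

lemma dir_deriv_subadditive:
  fixes f :: "'a::euclidean_space \<Rightarrow> real"
  assumes S: "open S" and f: "convex_on S f" and x: "x \<in> S"
  shows "dir_deriv f x (d + e) \<le> dir_deriv f x d + dir_deriv f x e"
  using dir_deriv_convex[OF S f x, of "1/2" "1/2" "2 *\<^sub>R d" "2 *\<^sub>R e"]
    dir_deriv_scale[OF S f x, of 2]
  by simp

lemma continuous_on_dir_deriv:
  fixes f :: "'a::euclidean_space \<Rightarrow> real"
  assumes S: "open S" and f: "convex_on S f" and x: "x \<in> S"
  shows "continuous_on UNIV (dir_deriv f x)"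
  by (rule convex_on_continuous)
    (auto simp: convex_on_def intro: dir_deriv_convex[OF S f x])

section \<open>Pointwise maxima\<close>

lemma isCont_Max:
  fixes f :: "'i \<Rightarrow> 'a::t2_space \<Rightarrow> real"
  assumes "finite J" "J \<noteq> {}" "\<And>j. j \<in> J \<Longrightarrow> isCont (f j) x"
  shows "isCont (\<lambda>y. Max ((\<lambda>j. f j y) ` J)) x"
  using assms
proof (induction J rule: finite_ne_induct)
  case (insert j J)
  then have "isCont (\<lambda>y. max (f j y) (Max ((\<lambda>j. f j y) ` J))) x"
    by (intro continuous_intros continuous_max) auto
  then show ?case using insert by simp
qed simp

text \<open>Near \<open>x\<close> only the active functions compete for the maximum, and to first order the one of
  steepest slope wins.\<close>

lemma has_dir_deriv_Max:
  fixes f :: "'i \<Rightarrow> 'a::euclidean_space \<Rightarrow> real"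
  assumes J: "finite J" "J \<noteq> {}"
    and c: "\<And>j. j \<in> J \<Longrightarrow> isCont (f j) x"
    and D: "\<And>j. j \<in> J \<Longrightarrow> has_dir_deriv (f j) x d (D j)"
  defines "M \<equiv> (\<lambda>y. Max ((\<lambda>j. f j y) ` J))"
  obtains j where "j \<in> J" "f j x = M x" "has_dir_deriv M x d (D j)"
proof -
  define A where "A = {j\<in>J. f j x = M x}"
  have "M x \<in> (\<lambda>j. f j x) ` J" unfolding M_def using J by (intro Max_in) auto
  then have A: "finite A" "A \<noteq> {}" using J by (auto simp: A_def)
  have "Max (D ` A) \<in> D ` A" using A by (intro Max_in) auto
  then obtain m where m: "m \<in> A" "D m = Max (D ` A)" by auto
  then have max: "D j \<le> D m" if "j \<in> A" for j using A that by simp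
  have ge: "f j y \<le> M y" if "j \<in> J" for j y
    unfolding M_def using J that by (intro Max_ge) auto
  have pos: "\<forall>\<^sub>F t in at_right (0::real). 0 < t" by (rule eventually_at_right_less)
  have "((\<lambda>t. (M (x + t *\<^sub>R d) - M x) / t) \<longlongrightarrow> D m) (at_right 0)"
  proof (rule order_tendstoI)
    fix a assume "a < D m"
    then have "\<forall>\<^sub>F t in at_right 0. a < (f m (x + t *\<^sub>R d) - f m x) / t"
      using D[of m] m by (auto simp: has_dir_deriv_def A_def intro: order_tendstoD)
    then show "\<forall>\<^sub>F t in at_right 0. a < (M (x + t *\<^sub>R d) - M x) / t"
      using pos
    proof eventually_elim
      case (elim t)
      have "f m (x + t *\<^sub>R d) - f m x \<le> M (x + t *\<^sub>R d) - M x"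
        using m ge[of m] by (simp add: A_def)
      then have "(f m (x + t *\<^sub>R d) - f m x) / t \<le> (M (x + t *\<^sub>R d) - M x) / t"
        using elim by (intro divide_right_mono) auto
      then show ?case using elim by simp
    qed
  next
    fix a assume a: "D m < a"
    have "\<forall>\<^sub>F t in at_right 0. f j (x + t *\<^sub>R d) < M x + a * t" if j: "j \<in> J" for j
    proof (cases "j \<in> A")
      case True
      then have "\<forall>\<^sub>F t in at_right 0. (f j (x + t *\<^sub>R d) - f j x) / t < a"
        using D[OF j] le_less_trans[OF max[OF True] a]
        by (auto simp: has_dir_deriv_def intro: order_tendstoD)
      then show ?thesis using pos
        by eventually_elim (use True in \<open>auto simp: A_def field_simps\<close>)
    next
      case False
      then have neg: "f j x - M x < 0" using ge[OF j, of x] j by (auto simp: A_def)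
      have "((\<lambda>t. f j (x + t *\<^sub>R d)) \<longlongrightarrow> f j x) (at_right 0)"
        using isCont_tendsto_compose[OF c[OF j] tendsto_ray] .
      then have "((\<lambda>t. f j (x + t *\<^sub>R d) - M x - a * t) \<longlongrightarrow> f j x - M x) (at_right 0)"
        by (auto intro!: tendsto_eq_intros)
      from order_tendstoD(2)[OF this neg] show ?thesis
        by eventually_elim simp
    qed
    then have "\<forall>\<^sub>F t in at_right 0. \<forall>j\<in>J. f j (x + t *\<^sub>R d) < M x + a * t"
      using J by (simp add: eventually_ball_finite)
    then show "\<forall>\<^sub>F t in at_right 0. (M (x + t *\<^sub>R d) - M x) / t < a"
      using pos
    proof eventually_elim
      case (elim t)
      then have "M (x + t *\<^sub>R d) < M x + a * t"
        unfolding M_def using J by (subst Max_less_iff) auto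
      then show ?case using elim by (simp add: field_simps)
    qed
  qed
  then show ?thesis using m that[of m] by (auto simp: A_def has_dir_deriv_def)
qed

section \<open>Feasible directions, polyhedra and piecewise affine functions\<close>

lemma convex_feasible_direction:
  assumes "convex X" "x \<in> X" "y \<in> X" "z \<in> X" "a \<ge> 0" "b \<ge> 0"
  shows "\<forall>\<^sub>F t in at_right 0. x + t *\<^sub>R (a *\<^sub>R (y - x) + b *\<^sub>R (z - x)) \<in> X"
proof -
  have ray: "\<forall>\<^sub>F t in at_right (0::real). x + (2 * t * c) *\<^sub>R (w - x) \<in> X"
    if "w \<in> X" "c \<ge> 0" for w c
  proof -
    have "((\<lambda>t. 2 * t * c) \<longlongrightarrow> 0) (at_right (0::real))"
      by (auto intro!: tendsto_eq_intros)
    then have "\<forall>\<^sub>F t in at_right (0::real). 2 * t * c < 1"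
      by (rule order_tendstoD) simp
    then show ?thesis using eventually_at_right_less[of 0]
    proof eventually_elim
      case (elim t)
      have "x + (2 * t * c) *\<^sub>R (w - x) = (1 - 2 * t * c) *\<^sub>R x + (2 * t * c) *\<^sub>R w"
        by (simp add: algebra_simps)
      also have "\<dots> \<in> X" using assms that elim by (intro convexD) auto
      finally show ?case .
    qed
  qed
  \<comment> \<open>The factor 2 above makes the target the midpoint of two points of \<open>X\<close>.\<close>
  show ?thesis
    using ray[OF assms(3,5)] ray[OF assms(4,6)]
  proof eventually_elim
    case (elim t)
    have "(1/2) *\<^sub>R (x + (2 * t * a) *\<^sub>R (y - x)) + (1/2) *\<^sub>R (x + (2 * t * b) *\<^sub>R (z - x)) \<in> X"
      using assms(1) elim by (intro convexD) auto
    also have "(1/2) *\<^sub>R (x + (2 * t * a) *\<^sub>R (y - x)) + (1/2) *\<^sub>R (x + (2 * t * b) *\<^sub>R (z - x))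
      = (1/2) *\<^sub>R x + (1/2) *\<^sub>R x + t *\<^sub>R (a *\<^sub>R (y - x) + b *\<^sub>R (z - x))"
      by (simp add: algebra_simps)
    also have "(1/2) *\<^sub>R x + (1/2) *\<^sub>R x = x" by (simp flip: scaleR_left_distrib)
    finally show ?case .
  qed
qed

lemma tangent_cone_mono: "Y \<subseteq> Z \<Longrightarrow> tangent_cone Y x \<subseteq> tangent_cone Z x"
  unfolding tangent_cone_def by blast

text \<open>Only the halfspaces that are tight at \<open>x\<close> restrict short steps, and a tangent direction
  respects these.\<close>

lemma polyhedron_tangent_feasible:
  fixes X :: "'a::euclidean_space set"
  assumes X: "polyhedron X" and x: "x \<in> X" and d: "d \<in> tangent_cone X x"
  shows "\<forall>\<^sub>F t in at_right 0. x + t *\<^sub>R d \<in> X"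
proof -
  obtain F where F: "finite F" "X = \<Inter>F" "\<And>h. h \<in> F \<Longrightarrow> \<exists>a b. h = {x. a \<bullet> x \<le> b}"
    using X unfolding polyhedron_def by metis
  obtain y s where y: "\<And>k. y k \<in> X" "\<And>k::nat. s k > 0" "(\<lambda>k. (y k - x) /\<^sub>R s k) \<longlonglongrightarrow> d"
    using d by (auto simp: tangent_cone_def)
  have "\<forall>\<^sub>F t in at_right 0. x + t *\<^sub>R d \<in> h" if h: "h \<in> F" for h
  proof -
    obtain a b where ab: "h = {x. a \<bullet> x \<le> b}" using F(3)[OF h] by blast
    have "a \<bullet> x \<le> b" using x F(2) h ab by auto
    show ?thesis
    proof (cases "a \<bullet> x = b")
      case True
      have "a \<bullet> d \<le> 0"
      proof (rule tendsto_upperbound)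
        show "(\<lambda>k. a \<bullet> ((y k - x) /\<^sub>R s k)) \<longlonglongrightarrow> a \<bullet> d" using y(3) by (intro tendsto_intros)
        have "a \<bullet> y k \<le> b" for k using y(1)[of k] F(2) h ab by auto
        then show "\<forall>\<^sub>F k in sequentially. a \<bullet> ((y k - x) /\<^sub>R s k) \<le> 0"
          using True y(2)
          by (simp add: inner_diff_right mult_nonneg_nonpos less_imp_le)
      qed simp
      then show ?thesis
        unfolding ab mem_Collect_eq
        by (intro eventually_mono[OF eventually_at_right_less[of 0]])
          (simp add: True inner_add_right mult_nonneg_nonpos)
    next
      case False
      then have "a \<bullet> x < b" using \<open>a \<bullet> x \<le> b\<close> by simp
      moreover have "((\<lambda>t. a \<bullet> (x + t *\<^sub>R d)) \<longlongrightarrow> a \<bullet> x) (at_right 0)"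
        by (intro tendsto_intros tendsto_ray)
      ultimately have "\<forall>\<^sub>F t in at_right 0. a \<bullet> (x + t *\<^sub>R d) < b"
        by (rule order_tendstoD(2)[rotated])
      then show ?thesis unfolding ab by eventually_elim simp
    qed
  qed
  then have "\<forall>\<^sub>F t in at_right 0. \<forall>h\<in>F. x + t *\<^sub>R d \<in> h"
    using F(1) by (simp add: eventually_ball_finite)
  then show ?thesis by eventually_elim (use F(2) in auto)
qed

text \<open>One of the finitely many closed convex pieces meets the ray in points arbitrarily near to
  \<open>x\<close>; it contains \<open>x\<close> and hence an initial segment of the ray.\<close>

lemma piecewise_affine_ray:
  fixes f :: "'a::euclidean_space \<Rightarrow> real"
  assumes f: "piecewise_affine_on X f" and d: "\<forall>\<^sub>F t in at_right 0. x + t *\<^sub>R d \<in> X"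
  obtains c where "\<forall>\<^sub>F t in at_right 0. f (x + t *\<^sub>R d) = f x + t * c"
proof -
  obtain F where F: "finite F" "X = \<Union>F" "\<And>Q. Q \<in> F \<Longrightarrow> polyhedron Q \<and> affine_fun_on Q f"
    using f unfolding piecewise_affine_on_def by metis
  have "\<exists>Q\<in>F. \<exists>\<^sub>F t in at_right 0. x + t *\<^sub>R d \<in> Q"
  proof (rule ccontr)
    assume "\<not> ?thesis"
    then have "\<forall>\<^sub>F t in at_right 0. \<forall>Q\<in>F. x + t *\<^sub>R d \<notin> Q"
      using F(1) by (simp add: eventually_ball_finite frequently_def)
    with d have "\<forall>\<^sub>F t in at_right (0::real). False"
      by eventually_elim (use F(2) in auto)
    then show False by simp
  qed
  then obtain Q where Q: "Q \<in> F" and fr: "\<exists>\<^sub>F t in at_right 0. x + t *\<^sub>R d \<in> Q" by blast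
  have clQ: "closed Q" "convex Q"
    using F(3)[OF Q] polyhedron_imp_closed polyhedron_imp_convex by blast+
  have xQ: "x \<in> Q"
  proof (rule ccontr)
    assume "x \<notin> Q"
    then have "\<forall>\<^sub>F t in at_right 0. x + t *\<^sub>R d \<in> - Q"
      using topological_tendstoD[OF tendsto_ray, of "- Q" x d] clQ by auto
    with fr show False by (simp add: frequently_def)
  qed
  have "\<exists>\<^sub>F t in at_right 0. x + t *\<^sub>R d \<in> Q \<and> 0 < t"
    using fr eventually_at_right_less[of 0] by (rule frequently_eventually_frequently)
  then obtain T where T: "T > 0" "x + T *\<^sub>R d \<in> Q"
    using frequently_ex by blast
  obtain a b where ab: "\<And>y. y \<in> Q \<Longrightarrow> f y = a \<bullet> y + b"
    using F(3)[OF Q] by (auto simp: affine_fun_on_def)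
  have "\<forall>\<^sub>F t in at_right 0. t < T"
    using T by (intro order_tendstoD[OF tendsto_ident_at])
  then have "\<forall>\<^sub>F t in at_right 0. f (x + t *\<^sub>R d) = f x + t * (a \<bullet> d)"
    using eventually_at_right_less[of 0]
  proof eventually_elim
    case (elim t)
    have "x + t *\<^sub>R d = (1 - t / T) *\<^sub>R x + (t / T) *\<^sub>R (x + T *\<^sub>R d)"
      using T by (simp add: algebra_simps)
    also have "\<dots> \<in> Q"
      using elim T xQ clQ(2) by (intro convexD) auto
    finally show ?case using ab xQ by (simp add: inner_add_right)
  qed
  then show ?thesis by (rule that)
qed

section \<open>The convex models of a DC program\<close>

text \<open>The convex function that takes the place of \<^term>\<open>dc_fun P i y\<close> in the subproblems: \<open>\<phi>\<^sub>i\<close> is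
  replaced by a quadratic, and \<open>\<psi>\<^sub>i\<close> by the linearization of its piece \<open>j\<close>, both expanded at
  \<open>xb\<close>.\<close>

definition dc_model :: "'a::euclidean_space dc_program \<Rightarrow> nat \<Rightarrow> nat \<Rightarrow> 'a \<Rightarrow> 'a \<Rightarrow> real" where
  "dc_model P i j y xb = phi_hat P i y xb + zeta P i y - linearization (psi_piece P i j) y xb"

text \<open>The directional derivative at \<open>x\<close> of the model expanded at \<open>x\<close> (see
  \<open>dc_model_has_dir_deriv\<close> below); it is a sublinear function of the direction.\<close>

definition dc_slope :: "'a::euclidean_space dc_program \<Rightarrow> nat \<Rightarrow> nat \<Rightarrow> 'a \<Rightarrow> 'a \<Rightarrow> real" where
  "dc_slope P i j x d =
     grad (phi P i) x \<bullet> d + dir_deriv (zeta P i) x d - grad (psi_piece P i j) x \<bullet> d"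

locale dc_program_data =
  fixes P :: "'a::euclidean_space dc_program"
  assumes dc: "dc_assumptions P"
begin

lemma xset_convex: "convex (xset P)"
  and xset_subset: "xset P \<subseteq> sdom P"
  and sdom_open: "open (sdom P)"
  using dc by (auto simp: dc_assumptions_def)

context
  fixes i assumes i: "i \<le> ncon P"
begin

lemma zeta_convex: "convex_on (sdom P) (zeta P i)"
  and phi_convex: "convex_on (sdom P) (phi P i)"
  and phi_C1: "C1_on (sdom P) (phi P i)"
  and psi_piece_convex: "j \<in> {1..npiece P i} \<Longrightarrow> convex_on (sdom P) (psi_piece P i j)"
  and psi_piece_C1: "j \<in> {1..npiece P i} \<Longrightarrow> C1_on (sdom P) (psi_piece P i j)"
  and npiece_pos: "npiece P i \<ge> 1"
  using dc i by (auto simp: dc_assumptions_def)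

lemma active_pieces_subset: "active_pieces P i x \<subseteq> {1..npiece P i}"
  by (auto simp: active_pieces_def)

context
  fixes x assumes x: "x \<in> sdom P"
begin

lemma isCont_grad: "C1_on (sdom P) f \<Longrightarrow> isCont (grad f) x"
  using x sdom_open by (auto simp: C1_on_def continuous_on_eq_continuous_at)

lemma isCont_C1: "C1_on (sdom P) f \<Longrightarrow> isCont f x"
  using x by (auto simp: C1_on_def intro: differentiable_imp_continuous_within)

lemma isCont_zeta: "isCont (zeta P i) x"
  using convex_on_continuous[OF sdom_open zeta_convex] x sdom_open
  by (simp add: continuous_on_eq_continuous_at)

lemma isCont_psi: "isCont (psi P i) x"
proof -
  have "isCont (\<lambda>y. Max ((\<lambda>j. psi_piece P i j y) ` {1..npiece P i})) x"
    using npiece_pos isCont_C1 psi_piece_C1 by (intro isCont_Max) auto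
  then show ?thesis by (simp add: psi_def[abs_def])
qed

lemma isCont_dc_fun: "isCont (dc_fun P i) x"
proof -
  have "isCont (\<lambda>x. phi P i x + zeta P i x - psi P i x) x"
    using isCont_psi isCont_zeta isCont_C1[OF phi_C1] by (intro continuous_intros)
  then show ?thesis by (simp add: dc_fun_def[abs_def])
qed

lemma dc_model_tendsto:
  assumes "j \<in> {1..npiece P i}" "(xb \<longlongrightarrow> x) F"
  shows "((\<lambda>k. dc_model P i j y (xb k)) \<longlongrightarrow> dc_model P i j y x) F"
proof -
  note c = isCont_C1[OF phi_C1] isCont_C1[OF psi_piece_C1[OF assms(1)]]
    isCont_grad[OF phi_C1] isCont_grad[OF psi_piece_C1[OF assms(1)]]
  note t = c[THEN isCont_tendsto_compose, OF assms(2)]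
  show ?thesis
    unfolding dc_model_def phi_hat_def linearization_def
    by (intro tendsto_intros t assms(2))
qed

lemma dc_model_self: "j \<in> active_pieces P i x \<Longrightarrow> dc_model P i j x x = dc_fun P i x"
  by (simp add: dc_model_def phi_hat_def linearization_def dc_fun_def active_pieces_def)

lemma active_piece_eventually_eps_active:
  assumes j: "j \<in> active_pieces P i x" and "\<epsilon> > 0" and xb: "(xb \<longlongrightarrow> x) F"
  shows "\<forall>\<^sub>F k in F. j \<in> eps_active_pieces P \<epsilon> i (xb k)"
proof -
  have jn: "j \<in> {1..npiece P i}" using j by (simp add: active_pieces_def)
  have "((\<lambda>k. psi P i (xb k) - psi_piece P i j (xb k)) \<longlongrightarrow> psi P i x - psi_piece P i j x) F"
    using isCont_tendsto_compose[OF isCont_psi xb]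
      isCont_tendsto_compose[OF isCont_C1[OF psi_piece_C1[OF jn]] xb]
    by (rule tendsto_diff)
  then have "\<forall>\<^sub>F k in F. psi P i (xb k) - psi_piece P i j (xb k) < \<epsilon>"
    using j \<open>\<epsilon> > 0\<close> by (intro order_tendstoD) (auto simp: active_pieces_def)
  then show ?thesis
    by eventually_elim (use jn in \<open>simp add: eps_active_pieces_def\<close>)
qed

lemma zeta_has_dir_deriv: "has_dir_deriv (zeta P i) x d (dir_deriv (zeta P i) x d)"
  by (rule convex_has_dir_deriv[OF sdom_open zeta_convex x])

text \<open>The quadratic term has zero derivative at its centre.\<close>

lemma dc_model_has_dir_deriv: "has_dir_deriv (\<lambda>y. dc_model P i j y x) x d (dc_slope P i j x d)"
proof -
  have "((\<lambda>y. phi_hat P i y x) has_derivative (\<lambda>h. grad (phi P i) x \<bullet> h)) (at x)"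
    unfolding phi_hat_def power2_norm_eq_inner by (auto intro!: derivative_eq_intros)
  moreover have "((\<lambda>y. linearization (psi_piece P i j) y x)
      has_derivative (\<lambda>h. grad (psi_piece P i j) x \<bullet> h)) (at x)"
    unfolding linearization_def by (auto intro!: derivative_eq_intros)
  ultimately show ?thesis
    unfolding dc_model_def dc_slope_def
    by (intro has_dir_deriv_add has_dir_deriv_diff zeta_has_dir_deriv
        has_dir_deriv_of_derivative[where f' = "\<lambda>h. _ \<bullet> h"])
qed

text \<open>In each direction the function has the same slope as the model built from a suitable active
  piece, one of steepest slope in that direction. This is what transfers first-order conditions
  from the models to the program.\<close>

lemma dc_fun_has_dir_deriv:
  obtains j where "j \<in> active_pieces P i x" "has_dir_deriv (dc_fun P i) x d (dc_slope P i j x d)"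
proof -
  have J: "finite {1..npiece P i}" "{1..npiece P i} \<noteq> {}" using npiece_pos by auto
  have cont: "isCont (psi_piece P i j) x" if "j \<in> {1..npiece P i}" for j
    by (rule isCont_C1[OF psi_piece_C1[OF that]])
  have D: "has_dir_deriv (psi_piece P i j) x d (grad (psi_piece P i j) x \<bullet> d)"
    if "j \<in> {1..npiece P i}" for j
    by (rule has_dir_deriv_of_derivative[OF has_gradient_grad[OF psi_piece_C1[OF that] x]])
  obtain j where j: "j \<in> {1..npiece P i}" "psi_piece P i j x = psi P i x"
    "has_dir_deriv (psi P i) x d (grad (psi_piece P i j) x \<bullet> d)"
    by (rule has_dir_deriv_Max[OF J cont D]) (auto simp: psi_def[abs_def])
  show ?thesis
  proof (rule that)
    show "j \<in> active_pieces P i x" using j by (simp add: active_pieces_def)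
    show "has_dir_deriv (dc_fun P i) x d (dc_slope P i j x d)"
      unfolding dc_fun_def[abs_def] dc_slope_def
      by (intro has_dir_deriv_add has_dir_deriv_diff zeta_has_dir_deriv j(3)
          has_dir_deriv_of_derivative[OF has_gradient_grad[OF phi_C1 x]])
  qed
qed

lemma active_pieces_nonempty: "active_pieces P i x \<noteq> {}"
  using dc_fun_has_dir_deriv[of 0] by blast

lemma dc_slope_tendsto:
  assumes "(v \<longlongrightarrow> d) F"
  shows "((\<lambda>k. dc_slope P i j x (v k)) \<longlongrightarrow> dc_slope P i j x d) F"
proof -
  have "isCont (dir_deriv (zeta P i) x) d"
    using continuous_on_dir_deriv[OF sdom_open zeta_convex x]
    by (simp add: continuous_on_eq_continuous_at)
  from isCont_tendsto_compose[OF this assms] show ?thesis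
    unfolding dc_slope_def by (intro tendsto_intros assms)
qed

lemma dc_slope_add_scale:
  assumes "s > 0"
  shows "dc_slope P i j x (d + s *\<^sub>R e) \<le> dc_slope P i j x d + s * dc_slope P i j x e"
  using dir_deriv_subadditive[OF sdom_open zeta_convex x, of d "s *\<^sub>R e"]
    dir_deriv_scale[OF sdom_open zeta_convex x assms, of e]
  by (simp add: dc_slope_def algebra_simps)

lemma C1_convex_lower_bound:
  assumes "C1_on (sdom P) f" "convex_on (sdom P) f" "y \<in> sdom P"
  shows "f x + grad f x \<bullet> (y - x) \<le> f y"
  using convex_dir_deriv_lower_bound[OF sdom_open assms(2) x assms(3)]
    dir_deriv_eqI[OF has_dir_deriv_of_derivative[OF has_gradient_grad[OF assms(1) x]]]
  by simp

end

text \<open>If all active pieces had positive slope along a tangent direction, then convexity would make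
  \<open>\<phi>\<^sub>i + \<zeta>\<^sub>i - \<psi>\<^sub>i\<^sub>j\<close> positive for every single piece \<open>j\<close> at the points that generate the
  direction: to first order for the active pieces, and by continuity for the others. These
  points would be infeasible.\<close>

lemma feasible_tangent_slope:
  assumes x: "x \<in> feasible_set P" and d: "d \<in> tangent_cone (feasible_set P) x"
    and i': "i \<in> active_constraints P x"
  shows "\<exists>j\<in>active_pieces P i x. dc_slope P i j x d \<le> 0"
proof (rule ccontr)
  assume "\<not> ?thesis"
  then have pos: "dc_slope P i j x d > 0" if "j \<in> active_pieces P i x" for j
    using that by force
  obtain y t where y: "\<And>k::nat. y k \<in> feasible_set P" "y \<longlonglongrightarrow> x" "\<And>k. t k > 0"
    and u: "(\<lambda>k. (y k - x) /\<^sub>R t k) \<longlonglongrightarrow> d"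
    using d by (auto simp: tangent_cone_def)
  define u where "u k = (y k - x) /\<^sub>R t k" for k
  have u: "u \<longlonglongrightarrow> d" using u by (simp add: u_def[abs_def])
  have yx: "y k - x = t k *\<^sub>R u k" for k using y(3)[of k] by (simp add: u_def)
  have xs: "x \<in> sdom P" and ys: "y k \<in> sdom P" for k
    using x y(1)[of k] xset_subset by (auto simp: feasible_set_def)
  have zero: "dc_fun P i x = 0" and i1: "i \<in> {1..ncon P}"
    using i' by (auto simp: active_constraints_def)
  have "\<forall>\<^sub>F k in sequentially. 0 < phi P i (y k) + zeta P i (y k) - psi_piece P i j (y k)"
    if j: "j \<in> {1..npiece P i}" for j
  proof (cases "j \<in> active_pieces P i x")
    case True
    have cont: "isCont (dir_deriv (zeta P i) x) d"
      using continuous_on_dir_deriv[OF sdom_open zeta_convex xs]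
      by (simp add: continuous_on_eq_continuous_at)
    have "(\<lambda>k. grad (phi P i) x \<bullet> u k + dir_deriv (zeta P i) x (u k)
        - grad (psi_piece P i j) (y k) \<bullet> u k) \<longlonglongrightarrow> dc_slope P i j x d"
      unfolding dc_slope_def
      by (intro tendsto_intros u isCont_tendsto_compose[OF cont]
          isCont_tendsto_compose[OF isCont_grad[OF xs psi_piece_C1[OF j]]] y(2))
    then have "\<forall>\<^sub>F k in sequentially. 0 < grad (phi P i) x \<bullet> u k + dir_deriv (zeta P i) x (u k)
        - grad (psi_piece P i j) (y k) \<bullet> u k"
      using pos[OF True] by (rule order_tendstoD)
    then show ?thesis
    proof eventually_elim
      case (elim k)
      have "0 < t k * (grad (phi P i) x \<bullet> u k + dir_deriv (zeta P i) x (u k)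
        - grad (psi_piece P i j) (y k) \<bullet> u k)"
        using elim y(3)[of k] by simp
      moreover have "phi P i x + t k * (grad (phi P i) x \<bullet> u k) \<le> phi P i (y k)"
        using C1_convex_lower_bound[OF xs phi_C1 phi_convex ys, of k] by (simp add: yx)
      moreover have "zeta P i x + t k * dir_deriv (zeta P i) x (u k) \<le> zeta P i (y k)"
        using convex_dir_deriv_lower_bound[OF sdom_open zeta_convex xs ys, of k]
        by (simp add: yx dir_deriv_scale[OF sdom_open zeta_convex xs y(3)])
      \<comment> \<open>An upper bound for \<open>\<psi>\<^sub>i\<^sub>j\<close> at \<open>y k\<close> is required, so its gradient is taken there and
        not at \<open>x\<close>.\<close>
      moreover have "psi_piece P i j (y k) - t k * (grad (psi_piece P i j) (y k) \<bullet> u k)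
          \<le> psi_piece P i j x"
        using C1_convex_lower_bound[OF ys psi_piece_C1[OF j] psi_piece_convex[OF j] xs, of k]
          arg_cong[OF yx[of k], of "\<lambda>v. grad (psi_piece P i j) (y k) \<bullet> v"]
        by (simp add: inner_diff_right)
      moreover have "phi P i x + zeta P i x - psi_piece P i j x = 0"
        using zero True by (simp add: dc_fun_def active_pieces_def)
      ultimately show ?case by (simp add: algebra_simps)
    qed
  next
    case False
    have "psi_piece P i j x \<le> psi P i x" unfolding psi_def using j by (intro Max_ge) auto
    with False j have "psi_piece P i j x < psi P i x" by (auto simp: active_pieces_def)
    then have "0 < phi P i x + zeta P i x - psi_piece P i j x"
      using zero by (simp add: dc_fun_def)
    moreover have "(\<lambda>k. phi P i (y k) + zeta P i (y k) - psi_piece P i j (y k))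
        \<longlonglongrightarrow> phi P i x + zeta P i x - psi_piece P i j x"
      by (intro tendsto_intros isCont_tendsto_compose[OF isCont_C1[OF xs phi_C1]]
         isCont_tendsto_compose[OF isCont_zeta[OF xs]]
         isCont_tendsto_compose[OF isCont_C1[OF xs psi_piece_C1[OF j]]] y(2))
    ultimately show ?thesis by (rule order_tendstoD(1)[rotated])
  qed
  then have "\<forall>\<^sub>F k in sequentially. \<forall>j\<in>{1..npiece P i}.
      0 < phi P i (y k) + zeta P i (y k) - psi_piece P i j (y k)"
    by (simp add: eventually_ball_finite)
  then obtain k where k: "\<forall>j\<in>{1..npiece P i}.
      0 < phi P i (y k) + zeta P i (y k) - psi_piece P i j (y k)"
    by (auto simp: eventually_sequentially)
  have "psi P i (y k) \<in> (\<lambda>j. psi_piece P i j (y k)) ` {1..npiece P i}"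
    unfolding psi_def using npiece_pos by (intro Max_in) auto
  then have "0 < dc_fun P i (y k)" using k by (auto simp: dc_fun_def)
  then show False using y(1)[of k] i1 by (force simp: feasible_set_def)
qed

end

end

section \<open>Stationarity from slopes\<close>

context dc_program_data
begin

text \<open>The pieces that linearize the objective and the constraints may be chosen anew for each tangent
  direction, so B-stationarity follows from a statement about the slopes of convex models.\<close>

lemma B_stationaryI_slopes:
  assumes x: "x \<in> feasible_set P"
    and slope: "\<And>d j0 j. d \<in> tangent_cone (feasible_set P) x \<Longrightarrow> j0 \<in> active_pieces P 0 x \<Longrightarrow>
      j \<in> active_tuples P x \<Longrightarrow> (\<forall>i\<in>active_constraints P x. dc_slope P i (j i) x d \<le> 0) \<Longrightarrow>
      0 \<le> dc_slope P 0 j0 x d"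
  shows "B_stationary (objective P) (feasible_set P) x"
  unfolding B_stationary_def
proof (intro conjI ballI)
  fix d assume d: "d \<in> tangent_cone (feasible_set P) x"
  have xs: "x \<in> sdom P" using x xset_subset by (auto simp: feasible_set_def)
  have "\<exists>j. j \<in> active_pieces P i x \<and> (i \<in> active_constraints P x \<longrightarrow> dc_slope P i j x d \<le> 0)"
    if "i \<in> {1..ncon P}" for i
    using feasible_tangent_slope[OF _ x d, of i] active_pieces_nonempty[OF _ xs, of i] that
    by (cases "i \<in> active_constraints P x") auto
  then obtain j where j: "\<And>i. i \<in> {1..ncon P} \<Longrightarrow> j i \<in> active_pieces P i x"
    "\<And>i. i \<in> active_constraints P x \<Longrightarrow> i \<in> {1..ncon P} \<Longrightarrow> dc_slope P i (j i) x d \<le> 0"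
    by metis
  obtain j0 where j0: "j0 \<in> active_pieces P 0 x"
    "has_dir_deriv (objective P) x d (dc_slope P 0 j0 x d)"
    using dc_fun_has_dir_deriv[OF _ xs, of 0] by auto
  have "0 \<le> dc_slope P 0 j0 x d"
  proof (rule slope[OF d j0(1)])
    show "restrict j {1..ncon P} \<in> active_tuples P x"
      using j by (auto simp: active_tuples_def)
    show "\<forall>i\<in>active_constraints P x. dc_slope P i (restrict j {1..ncon P} i) x d \<le> 0"
      using j(2) by (auto simp: active_constraints_def)
  qed
  with j0 show "\<exists>D. has_dir_deriv (objective P) x d D \<and> 0 \<le> D" by blast
qed (rule x)

end

section \<open>The run of the method\<close>

locale alm_limit = dc_program_data P
  for P :: "'a::euclidean_space dc_program" +
  fixes \<epsilon> \<alpha> \<sigma> :: real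
    and \<eta> \<rho> :: "nat \<Rightarrow> real"
    and l :: "nat \<Rightarrow> nat \<Rightarrow> real"
    and x :: "nat \<Rightarrow> 'a"
    and xinf :: 'a
    and r :: "nat \<Rightarrow> nat"
  assumes run: "alm_run P \<epsilon> \<alpha> \<sigma> \<eta> x l \<rho>"
    and r: "strict_mono r"
    and x_tendsto: "(x \<circ> r) \<longlonglongrightarrow> xinf"
begin

lemma x_in: "x k \<in> xset P"
  using run by (auto simp: alm_run_def)

lemma xr_tendsto: "(\<lambda>k. x (r k)) \<longlonglongrightarrow> xinf"
  using x_tendsto by (simp add: o_def)

lemma xinf_in: "xinf \<in> xset P"
proof -
  have "closed (xset P)" using dc by (simp add: dc_assumptions_def)
  then show ?thesis
    using closed_sequentially[of "xset P" "\<lambda>k. x (r k)" xinf] x_in xr_tendsto by auto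
qed

lemma xinf_sdom: "xinf \<in> sdom P"
  using xinf_in xset_subset by auto

lemma rho_ge: "\<sigma> ^ k * \<rho> 0 \<le> \<rho> k"
proof (induction k)
  case (Suc k)
  have "\<sigma> * (\<sigma> ^ k * \<rho> 0) \<le> \<sigma> * \<rho> k"
    using Suc run by (intro mult_left_mono) (auto simp: alm_run_def)
  also have "\<dots> \<le> \<rho> (Suc k)" using run by (simp add: alm_run_def)
  finally show ?case by (simp add: mult.assoc)
qed simp

lemma rho_pos: "\<rho> k > 0"
proof -
  have "0 < \<sigma> ^ k * \<rho> 0" using run by (auto simp: alm_run_def)
  then show ?thesis using rho_ge[of k] by linarith
qed

lemma rho_at_top: "filterlim (\<lambda>k. \<rho> (r k)) at_top sequentially"
proof -
  have "filterlim (\<lambda>k. \<sigma> ^ k) at_top sequentially"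
    using run
    by (intro filterlim_at_infinity_imp_filterlim_at_top filterlim_realpow_sequentially_gt1)
      (auto simp: alm_run_def)
  then have "filterlim (\<lambda>k. \<sigma> ^ k * \<rho> 0) at_top sequentially"
    by (rule filterlim_at_top_mult_tendsto_pos[rotated 2, OF _ tendsto_const])
      (use rho_pos[of 0] in simp)
  then have "filterlim \<rho> at_top sequentially"
    by (rule filterlim_at_top_mono) (simp add: rho_ge)
  then show ?thesis
    by (rule filterlim_compose[OF _ filterlim_subseq[OF r]])
qed

lemma divide_rho_tendsto_0: "(f \<longlongrightarrow> c) sequentially \<Longrightarrow> (\<lambda>k. f k / \<rho> (r k)) \<longlonglongrightarrow> 0"
  by (rule real_tendsto_divide_at_top[OF _ rho_at_top])

lemma l_nonneg: "i \<in> {1..ncon P} \<Longrightarrow> l k i \<ge> 0"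
  using run by (cases k) (auto simp: alm_run_def)

text \<open>The update of the penalty parameter enforces \<open>\<parallel>\<lambda>\<parallel>\<^sup>1\<^sup>+\<^sup>\<alpha> \<le> \<rho>\<close>, so every power of the
  multipliers below \<open>1 + \<alpha>\<close> is negligible against the penalty parameter.\<close>

lemma multiplier_power_negligible:
  assumes i: "i \<in> {1..ncon P}" and p: "p > 0" "p < 1 + \<alpha>"
  shows "(\<lambda>k. l (r k) i powr p / \<rho> (r k)) \<longlonglongrightarrow> 0"
proof (rule Lim_null_comparison)
  have \<alpha>: "\<alpha> > 0" using run by (simp add: alm_run_def)
  have "filterlim (\<lambda>k. \<rho> (r k)) at_top sequentially" by (rule rho_at_top)
  moreover have "p / (1 + \<alpha>) - 1 < 0" using p \<alpha> by simp
  ultimately show "(\<lambda>k. \<rho> (r k) powr (p / (1 + \<alpha>) - 1)) \<longlonglongrightarrow> 0"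
    by (rule tendsto_neg_powr[rotated])
  show "\<forall>\<^sub>F k in sequentially.
      norm (l (r k) i powr p / \<rho> (r k)) \<le> \<rho> (r k) powr (p / (1 + \<alpha>) - 1)"
  proof (rule eventually_sequentiallyI[of 1])
    \<comment> \<open>The initial multiplier \<open>l 0\<close> is not controlled by \<open>\<rho> 0\<close>.\<close>
    fix k :: nat assume "1 \<le> k"
    then have "r k \<ge> 1" using seq_suble[OF r, of k] by simp
    then obtain m where m: "r k = Suc m" by (cases "r k") auto
    let ?N = "L2_set (l (Suc m)) {1..ncon P}" and ?R = "\<rho> (Suc m)"
    have R: "?R > 0" by (rule rho_pos)
    have "?N powr (1 + \<alpha>) \<le> ?R"
      using run by (simp add: alm_run_def)
    then have "(?N powr (1 + \<alpha>)) powr (p / (1 + \<alpha>)) \<le> ?R powr (p / (1 + \<alpha>))"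
      using p \<alpha> by (intro powr_mono2) auto
    then have "?N powr p \<le> ?R powr (p / (1 + \<alpha>))"
      using \<alpha> by (simp add: powr_powr)
    moreover have "l (Suc m) i powr p \<le> ?N powr p"
      using i p l_nonneg[OF i, of "Suc m"]
      by (intro powr_mono2 member_le_L2_set) auto
    ultimately have "l (Suc m) i powr p / ?R \<le> ?R powr (p / (1 + \<alpha>)) / ?R"
      using R by (intro divide_right_mono) auto
    then show "norm (l (r k) i powr p / \<rho> (r k)) \<le> \<rho> (r k) powr (p / (1 + \<alpha>) - 1)"
      using R by (simp add: m powr_diff)
  qed
qed

lemma multiplier_ratio_tendsto_0:
  assumes i: "i \<in> {1..ncon P}"
  shows "(\<lambda>k. l (r k) i / \<rho> (r k)) \<longlonglongrightarrow> 0"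
proof -
  have "1 < 1 + \<alpha>" using run by (simp add: alm_run_def)
  from multiplier_power_negligible[OF i _ this] show ?thesis
    using l_nonneg[OF i] by simp
qed

lemma active_tuple_piece:
  "j \<in> active_tuples P xinf \<Longrightarrow> i \<in> {1..ncon P} \<Longrightarrow> j i \<in> active_pieces P i xinf"
  by (auto simp: active_tuples_def)

text \<open>The two occurrences of \<open>\<Sum>\<^sub>i \<lambda>\<^sub>i\<^sup>2\<close> in the subproblem condition cancel, and pieces active in the
  limit are \<open>\<epsilon>\<close>-active at late iterates.\<close>

lemma subproblem_inequality:
  assumes y: "y \<in> xset P" and j0: "j0 \<in> active_pieces P 0 xinf"
    and j: "j \<in> active_tuples P xinf"
  shows "\<forall>\<^sub>F k in sequentially.
    objective P (x (r k))
      + (\<Sum>i=1..ncon P. (max (l (r k) i + \<rho> (r k) * dc_fun P i (x (r k))) 0)\<^sup>2) / (2 * \<rho> (r k))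
    \<le> dc_model P 0 j0 y (x (r k))
      + (\<Sum>i=1..ncon P. (max (l (r k) i + \<rho> (r k) * dc_model P i (j i) y (x (r k))) 0)\<^sup>2)
          / (2 * \<rho> (r k)) + \<eta> (r k)"
proof -
  have "\<epsilon> > 0" using run by (simp add: alm_run_def)
  have "\<forall>\<^sub>F k in sequentially. j0 \<in> eps_active_pieces P \<epsilon> 0 (x (r k))"
    by (rule active_piece_eventually_eps_active[OF _ xinf_sdom j0 \<open>\<epsilon> > 0\<close> xr_tendsto]) simp
  moreover have "\<forall>\<^sub>F k in sequentially. \<forall>i\<in>{1..ncon P}. j i \<in> eps_active_pieces P \<epsilon> i (x (r k))"
    using active_piece_eventually_eps_active[OF _ xinf_sdom active_tuple_piece[OF j] \<open>\<epsilon> > 0\<close> xr_tendsto]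
    by (simp add: eventually_ball_finite)
  ultimately show ?thesis
  proof eventually_elim
    case (elim k)
    have "j \<in> eps_active_tuples P \<epsilon> (x (r k))"
      using j elim by (auto simp: eps_active_tuples_def active_tuples_def PiE_def Pi_def)
    then have "F_tilde P (\<rho> (r k)) (x (r k)) (l (r k))
        \<le> Q_tilde P (\<rho> (r k)) y (x (r k)) (l (r k)) j0 j + \<eta> (r k)"
      using run y elim by (simp add: alm_run_def)
    then show ?case
      by (simp add: F_tilde_def Q_tilde_def dc_model_def sum_subtractf diff_divide_distrib)
  qed
qed

lemma dc_fun_run_tendsto:
  "i \<le> ncon P \<Longrightarrow> (\<lambda>k. dc_fun P i (x (r k))) \<longlonglongrightarrow> dc_fun P i xinf"
  by (rule isCont_tendsto_compose[OF isCont_dc_fun[OF _ xinf_sdom] xr_tendsto])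

lemma dc_model_run_tendsto:
  "i \<le> ncon P \<Longrightarrow> j \<in> active_pieces P i xinf \<Longrightarrow>
    (\<lambda>k. dc_model P i j y (x (r k))) \<longlonglongrightarrow> dc_model P i j y xinf"
  using dc_model_tendsto[OF _ xinf_sdom _ xr_tendsto] active_pieces_subset by blast

lemma eta_tendsto: "(\<lambda>k. \<eta> (r k)) \<longlonglongrightarrow> 0"
  using run LIMSEQ_subseq_LIMSEQ[OF _ r, of \<eta> 0] by (simp add: alm_run_def o_def)

lemma squared_penalty_scale:
  "(max (l k i + \<rho> k * c) 0)\<^sup>2 = (\<rho> k)\<^sup>2 * (max (l k i / \<rho> k + c) 0)\<^sup>2"
proof -
  have "l k i + \<rho> k * c = \<rho> k * (l k i / \<rho> k + c)"
    using rho_pos[of k] by (simp add: algebra_simps)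
  moreover have "max (\<rho> k * (l k i / \<rho> k + c)) 0 = \<rho> k * max (l k i / \<rho> k + c) 0"
    using rho_pos[of k] by (simp add: max_mult_distrib_left)
  ultimately show ?thesis by (simp add: power_mult_distrib)
qed

text \<open>Divided by the penalty parameter, the subproblem condition retains only the penalty term.\<close>

lemma limit_minimizes_penalty_model:
  assumes y: "y \<in> xset P" and j: "j \<in> active_tuples P xinf"
  shows "(\<Sum>i=1..ncon P. (max (dc_fun P i xinf) 0)\<^sup>2)
    \<le> (\<Sum>i=1..ncon P. (max (dc_model P i (j i) y xinf) 0)\<^sup>2)"
proof -
  obtain j0 where j0: "j0 \<in> active_pieces P 0 xinf"
    using active_pieces_nonempty[OF _ xinf_sdom, of 0] by auto
  let ?G = "\<lambda>k. \<Sum>i=1..ncon P. (max (l (r k) i / \<rho> (r k) + dc_fun P i (x (r k))) 0)\<^sup>2"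
  let ?H = "\<lambda>k. \<Sum>i=1..ncon P. (max (l (r k) i / \<rho> (r k) + dc_model P i (j i) y (x (r k))) 0)\<^sup>2"
  let ?R = "\<lambda>k. 2 * (dc_model P 0 j0 y (x (r k)) + \<eta> (r k) - objective P (x (r k)))"
  have "?R \<longlonglongrightarrow> 2 * (dc_model P 0 j0 y xinf + 0 - objective P xinf)"
    by (intro tendsto_intros dc_model_run_tendsto j0 eta_tendsto dc_fun_run_tendsto le0)
  then have "(\<lambda>k. ?R k / \<rho> (r k)) \<longlonglongrightarrow> 0"
    by (rule divide_rho_tendsto_0)
  moreover have "?H \<longlonglongrightarrow> (\<Sum>i=1..ncon P. (max (0 + dc_model P i (j i) y xinf) 0)\<^sup>2)"
    by (intro tendsto_intros multiplier_ratio_tendsto_0 dc_model_run_tendsto active_tuple_piece[OF j])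
      auto
  ultimately have H: "(\<lambda>k. ?R k / \<rho> (r k) + ?H k)
      \<longlonglongrightarrow> 0 + (\<Sum>i=1..ncon P. (max (0 + dc_model P i (j i) y xinf) 0)\<^sup>2)"
    by (rule tendsto_add)
  have G: "?G \<longlonglongrightarrow> (\<Sum>i=1..ncon P. (max (0 + dc_fun P i xinf) 0)\<^sup>2)"
    by (intro tendsto_intros multiplier_ratio_tendsto_0 dc_fun_run_tendsto) auto
  have "\<forall>\<^sub>F k in sequentially. ?G k \<le> ?R k / \<rho> (r k) + ?H k"
    using subproblem_inequality[OF y j0 j]
  proof eventually_elim
    case (elim k)
    let ?\<rho> = "\<rho> (r k)"
    have \<rho>: "?\<rho> > 0" by (rule rho_pos)
    have *: "?\<rho>\<^sup>2 * s / (2 * ?\<rho>) = ?\<rho> * s / 2" for s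
      using \<rho> by (simp add: power2_eq_square)
    have "?\<rho> * ?G k \<le> ?R k + ?\<rho> * ?H k"
      using elim unfolding squared_penalty_scale sum_distrib_left[symmetric] * by simp
    then show ?case using \<rho> by (simp add: field_simps)
  qed
  from tendsto_le[OF _ H G this] show ?thesis by simp
qed

text \<open>At a point \<open>y\<close> whose penalty terms vanish in the limit, dropping the nonnegative penalty of the
  iterates leaves a comparison of objectives.\<close>

lemma limit_minimizes_objective_model:
  assumes y: "y \<in> xset P" and j0: "j0 \<in> active_pieces P 0 xinf"
    and j: "j \<in> active_tuples P xinf"
    and pen: "\<And>i. i \<in> {1..ncon P} \<Longrightarrow>
      (\<lambda>k. (max (l (r k) i + \<rho> (r k) * dc_model P i (j i) y (x (r k))) 0)\<^sup>2 / \<rho> (r k)) \<longlonglongrightarrow> 0"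
  shows "objective P xinf \<le> dc_model P 0 j0 y xinf"
proof -
  let ?H = "\<lambda>k i. (max (l (r k) i + \<rho> (r k) * dc_model P i (j i) y (x (r k))) 0)\<^sup>2 / \<rho> (r k)"
  have H: "(\<lambda>k. dc_model P 0 j0 y (x (r k)) + (\<Sum>i=1..ncon P. ?H k i) / 2 + \<eta> (r k))
    \<longlonglongrightarrow> dc_model P 0 j0 y xinf + (\<Sum>i=1..ncon P. 0) / 2 + 0"
    by (intro tendsto_intros dc_model_run_tendsto j0 eta_tendsto pen le0) auto
  have "\<forall>\<^sub>F k in sequentially. objective P (x (r k))
      \<le> dc_model P 0 j0 y (x (r k)) + (\<Sum>i=1..ncon P. ?H k i) / 2 + \<eta> (r k)"
    using subproblem_inequality[OF y j0 j]
  proof eventually_elim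
    case (elim k)
    have "0 \<le> (\<Sum>i=1..ncon P. (max (l (r k) i + \<rho> (r k) * dc_fun P i (x (r k))) 0)\<^sup>2)
        / (2 * \<rho> (r k))"
      using rho_pos[of "r k"] by (intro divide_nonneg_nonneg sum_nonneg) auto
    then show ?case using elim by (simp add: sum_divide_distrib mult.commute)
  qed
  from tendsto_le[OF _ H dc_fun_run_tendsto this] show ?thesis by simp
qed

text \<open>Where a constraint model is negative, its penalty term is eventually zero: the multiplier is of
  smaller order than \<open>\<rho>\<close>.\<close>

lemma penalty_vanishes_if_model_negative:
  assumes i: "i \<in> {1..ncon P}" and j: "j \<in> active_pieces P i xinf"
    and neg: "dc_model P i j y xinf < 0"
  shows "(\<lambda>k. (max (l (r k) i + \<rho> (r k) * dc_model P i j y (x (r k))) 0)\<^sup>2 / \<rho> (r k)) \<longlonglongrightarrow> 0"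
proof -
  have "(\<lambda>k. l (r k) i / \<rho> (r k) + dc_model P i j y (x (r k))) \<longlonglongrightarrow> 0 + dc_model P i j y xinf"
    using i by (intro tendsto_intros multiplier_ratio_tendsto_0 dc_model_run_tendsto j) auto
  then have "\<forall>\<^sub>F k in sequentially. l (r k) i / \<rho> (r k) + dc_model P i j y (x (r k)) < 0"
    using neg by (intro order_tendstoD) auto
  then have "\<forall>\<^sub>F k in sequentially.
      (max (l (r k) i + \<rho> (r k) * dc_model P i j y (x (r k))) 0)\<^sup>2 / \<rho> (r k) = 0"
    by eventually_elim (simp add: squared_penalty_scale)
  then show ?thesis by (rule tendsto_eventually)
qed

lemma inactive_model_eventually_negative:
  assumes x: "xinf \<in> feasible_set P" and i: "i \<in> {1..ncon P}" "i \<notin> active_constraints P xinf"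
    and j: "j \<in> active_pieces P i xinf"
  shows "\<forall>\<^sub>F t in at_right 0. dc_model P i j (xinf + t *\<^sub>R v) xinf < 0"
proof -
  have i': "i \<le> ncon P" using i by simp
  have "dc_fun P i xinf \<le> 0" "dc_fun P i xinf \<noteq> 0"
    using x i by (auto simp: feasible_set_def active_constraints_def)
  then have "dc_model P i j xinf xinf < 0"
    using dc_model_self[OF i' xinf_sdom j] by simp
  then show ?thesis
    using has_dir_deriv_tendsto[OF dc_model_has_dir_deriv[OF i' xinf_sdom], of j v]
    by (rule order_tendstoD(2)[rotated])
qed

lemma objective_slope_nonneg:
  assumes j0: "j0 \<in> active_pieces P 0 xinf"
    and "\<forall>\<^sub>F t in at_right 0. objective P xinf \<le> dc_model P 0 j0 (xinf + t *\<^sub>R v) xinf"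
  shows "0 \<le> dc_slope P 0 j0 xinf v"
  using dc_model_has_dir_deriv[OF le0 xinf_sdom]
  by (rule has_dir_deriv_nonneg) (use assms dc_model_self[OF le0 xinf_sdom j0] in simp)

text \<open>A direction along which the active constraint models decrease strictly leads to points where
  no penalty is paid in the limit, so it cannot be a descent direction of the objective
  model.\<close>

lemma objective_slope_nonneg_strict:
  assumes x: "xinf \<in> feasible_set P"
    and j0: "j0 \<in> active_pieces P 0 xinf" and j: "j \<in> active_tuples P xinf"
    and v: "\<forall>\<^sub>F t in at_right 0. xinf + t *\<^sub>R v \<in> xset P"
    and neg: "\<And>i. i \<in> active_constraints P xinf \<Longrightarrow> dc_slope P i (j i) xinf v < 0"
  shows "0 \<le> dc_slope P 0 j0 xinf v"
proof (rule objective_slope_nonneg[OF j0])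
  have "\<forall>\<^sub>F t in at_right 0. dc_model P i (j i) (xinf + t *\<^sub>R v) xinf < 0"
    if i: "i \<in> {1..ncon P}" for i
  proof (cases "i \<in> active_constraints P xinf")
    case True
    have i': "i \<le> ncon P" using i by simp
    have "dc_model P i (j i) xinf xinf = 0"
      using True dc_model_self[OF i' xinf_sdom active_tuple_piece[OF j i]]
      by (simp add: active_constraints_def)
    then show ?thesis
      using has_dir_deriv_eventually_less[OF dc_model_has_dir_deriv[OF i' xinf_sdom] neg[OF True]]
      by simp
  qed (rule inactive_model_eventually_negative[OF x i _ active_tuple_piece[OF j i]])
  then have "\<forall>\<^sub>F t in at_right 0. \<forall>i\<in>{1..ncon P}. dc_model P i (j i) (xinf + t *\<^sub>R v) xinf < 0"
    by (simp add: eventually_ball_finite)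
  with v show "\<forall>\<^sub>F t in at_right 0. objective P xinf \<le> dc_model P 0 j0 (xinf + t *\<^sub>R v) xinf"
  proof eventually_elim
    case (elim t)
    then show ?case
      by (intro limit_minimizes_objective_model[OF _ j0 j] penalty_vanishes_if_model_negative
          active_tuple_piece[OF j]) auto
  qed
qed

section \<open>Stationarity of the limit point\<close>

text \<open>With the pieces chosen for the direction at hand, the infeasibility measure and its model have
  the same value and the same slope at the limit point, which minimizes the model.\<close>

lemma limit_D_stationary_infeasibility:
  "D_stationary (\<lambda>y. \<Sum>i=1..ncon P. (max (dc_fun P i y) 0)\<^sup>2) (xset P) xinf"
  unfolding D_stationary_def
proof (intro conjI ballI xinf_in)
  fix y assume y: "y \<in> xset P"
  define d where "d = y - xinf"
  have "\<exists>j. j \<in> active_pieces P i xinf \<and>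
      has_dir_deriv (dc_fun P i) xinf d (dc_slope P i j xinf d)" if "i \<in> {1..ncon P}" for i
    using dc_fun_has_dir_deriv[OF _ xinf_sdom, of i d] that by auto
  then obtain j' where j': "\<And>i. i \<in> {1..ncon P} \<Longrightarrow> j' i \<in> active_pieces P i xinf"
    "\<And>i. i \<in> {1..ncon P} \<Longrightarrow> has_dir_deriv (dc_fun P i) xinf d (dc_slope P i (j' i) xinf d)"
    by metis
  define j where "j = restrict j' {1..ncon P}"
  have j: "j \<in> active_tuples P xinf" using j' by (auto simp: j_def active_tuples_def)
  define D where
    "D = (\<Sum>i=1..ncon P. 2 * max (dc_fun P i xinf) 0 * dc_slope P i (j i) xinf d)"
  have D: "has_dir_deriv (\<lambda>y. \<Sum>i=1..ncon P. (max (dc_fun P i y) 0)\<^sup>2) xinf d D"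
    unfolding D_def using j'(2)
    by (intro has_dir_deriv_sum has_dir_deriv_max_0_square) (auto simp: j_def)
  have self: "dc_model P i (j i) xinf xinf = dc_fun P i xinf" if "i \<in> {1..ncon P}" for i
    using that dc_model_self[OF _ xinf_sdom active_tuple_piece[OF j that]] by simp
  have "has_dir_deriv (\<lambda>y. \<Sum>i=1..ncon P. (max (dc_model P i (j i) y xinf) 0)\<^sup>2) xinf d
      (\<Sum>i=1..ncon P. 2 * max (dc_model P i (j i) xinf xinf) 0 * dc_slope P i (j i) xinf d)"
    by (intro has_dir_deriv_sum has_dir_deriv_max_0_square dc_model_has_dir_deriv xinf_sdom) auto
  also have "(\<Sum>i=1..ncon P. 2 * max (dc_model P i (j i) xinf xinf) 0 * dc_slope P i (j i) xinf d)
      = D"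
    unfolding D_def by (intro sum.cong) (auto simp: self)
  finally have "0 \<le> D"
  proof (rule has_dir_deriv_nonneg)
    have "\<forall>\<^sub>F t in at_right 0. xinf + t *\<^sub>R (1 *\<^sub>R (y - xinf) + 0 *\<^sub>R (y - xinf)) \<in> xset P"
      by (rule convex_feasible_direction[OF xset_convex xinf_in y y]) auto
    then show "\<forall>\<^sub>F t in at_right 0. (\<Sum>i=1..ncon P. (max (dc_model P i (j i) xinf xinf) 0)\<^sup>2)
        \<le> (\<Sum>i=1..ncon P. (max (dc_model P i (j i) (xinf + t *\<^sub>R d) xinf) 0)\<^sup>2)"
    proof eventually_elim
      case (elim t)
      then show ?case using limit_minimizes_penalty_model[OF _ j, of "xinf + t *\<^sub>R d"]
        by (simp add: self d_def)
    qed
  qed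
  with D show "\<exists>D. has_dir_deriv (\<lambda>y. \<Sum>i=1..ncon P. (max (dc_fun P i y) 0)\<^sup>2) xinf (y - xinf) D
      \<and> 0 \<le> D"
    by (auto simp: d_def)
qed

lemma limit_D_stationary_objective:
  assumes x: "xinf \<in> feasible_set P" and none: "active_constraints P xinf = {}"
  shows "D_stationary (objective P) (xset P) xinf"
  unfolding D_stationary_def
proof (intro conjI ballI xinf_in)
  fix y assume y: "y \<in> xset P"
  obtain j0 where j0: "j0 \<in> active_pieces P 0 xinf"
    "has_dir_deriv (objective P) xinf (y - xinf) (dc_slope P 0 j0 xinf (y - xinf))"
    using dc_fun_has_dir_deriv[OF le0 xinf_sdom] by auto
  obtain j where j: "j \<in> active_tuples P xinf"
  proof -
    have "active_tuples P xinf \<noteq> {}"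
      using active_pieces_nonempty[OF _ xinf_sdom] by (auto simp: active_tuples_def PiE_eq_empty_iff)
    then show ?thesis using that by blast
  qed
  have "\<forall>\<^sub>F t in at_right 0. xinf + t *\<^sub>R (1 *\<^sub>R (y - xinf) + 0 *\<^sub>R (y - xinf)) \<in> xset P"
    by (rule convex_feasible_direction[OF xset_convex xinf_in y y]) auto
  then have "0 \<le> dc_slope P 0 j0 xinf (y - xinf)"
    by (intro objective_slope_nonneg_strict[OF x j0(1) j]) (auto simp: none)
  with j0 show "\<exists>D. has_dir_deriv (objective P) xinf (y - xinf) D \<and> 0 \<le> D" by blast
qed

text \<open>A tangent direction \<open>d\<close> of the feasible set is perturbed to \<open>d + s e\<close> with a Slater direction
  \<open>e\<close>; this makes the slopes of the active constraint models negative. The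
  perturbed direction is a limit of feasible directions of \<open>X\<close>, to which the strict case applies,
  and \<open>s\<close> then tends to \<open>0\<close>.\<close>

lemma limit_B_stationary_PSCQ:
  assumes x: "xinf \<in> feasible_set P" and pscq: "PSCQ P xinf"
  shows "B_stationary (objective P) (feasible_set P) xinf"
proof (rule B_stationaryI_slopes[OF x])
  fix d j0 j
  assume d: "d \<in> tangent_cone (feasible_set P) xinf"
    and j0: "j0 \<in> active_pieces P 0 xinf" and j: "j \<in> active_tuples P xinf"
    and le: "\<forall>i\<in>active_constraints P xinf. dc_slope P i (j i) xinf d \<le> 0"
  obtain e where e: "e \<in> tangent_cone (xset P) xinf"
    and slater: "\<And>i. i \<in> active_constraints P xinf \<Longrightarrow> dc_slope P i (j i) xinf e < 0"
    using pscq j unfolding PSCQ_def dc_slope_def by blast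
  obtain y t where y: "\<And>k::nat. y k \<in> xset P" "\<And>k. t k > 0" "(\<lambda>k. (y k - xinf) /\<^sub>R t k) \<longlonglongrightarrow> d"
    using d by (auto simp: tangent_cone_def feasible_set_def)
  obtain z \<tau> where z: "\<And>k::nat. z k \<in> xset P" "\<And>k. \<tau> k > 0" "(\<lambda>k. (z k - xinf) /\<^sub>R \<tau> k) \<longlonglongrightarrow> e"
    using e by (auto simp: tangent_cone_def)
  have perturbed: "0 \<le> dc_slope P 0 j0 xinf (d + s *\<^sub>R e)" if s: "s > 0" for s
  proof -
    define v where "v k = inverse (t k) *\<^sub>R (y k - xinf) + (s * inverse (\<tau> k)) *\<^sub>R (z k - xinf)" for k
    have v: "v \<longlonglongrightarrow> d + s *\<^sub>R e"
    proof -
      have "(\<lambda>k. (y k - xinf) /\<^sub>R t k + s *\<^sub>R ((z k - xinf) /\<^sub>R \<tau> k)) \<longlonglongrightarrow> d + s *\<^sub>R e"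
        by (intro tendsto_intros y z)
      then show ?thesis by (simp add: v_def[abs_def])
    qed
    have feas: "\<forall>\<^sub>F \<theta> in at_right 0. xinf + \<theta> *\<^sub>R v k \<in> xset P" for k
      unfolding v_def using y(1,2)[of k] z(1,2)[of k] s
      by (intro convex_feasible_direction xset_convex xinf_in) auto
    have "\<forall>\<^sub>F k in sequentially. dc_slope P i (j i) xinf (v k) < 0"
      if i: "i \<in> active_constraints P xinf" for i
    proof -
      have i': "i \<le> ncon P" using i by (simp add: active_constraints_def)
      have "dc_slope P i (j i) xinf (d + s *\<^sub>R e)
          \<le> dc_slope P i (j i) xinf d + s * dc_slope P i (j i) xinf e"
        by (rule dc_slope_add_scale[OF i' xinf_sdom s])
      also have "\<dots> < 0"
        using le i mult_pos_neg[OF s slater[OF i]] by fastforce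
      finally show ?thesis
        using dc_slope_tendsto[OF i' xinf_sdom v, of "j i"] by (rule order_tendstoD(2)[rotated])
    qed
    moreover have "finite (active_constraints P xinf)" by (simp add: active_constraints_def)
    ultimately have "\<forall>\<^sub>F k in sequentially. \<forall>i\<in>active_constraints P xinf.
        dc_slope P i (j i) xinf (v k) < 0"
      by (simp add: eventually_ball_finite)
    then have "\<forall>\<^sub>F k in sequentially. 0 \<le> dc_slope P 0 j0 xinf (v k)"
      by eventually_elim (intro objective_slope_nonneg_strict[OF x j0 j feas], auto)
    from tendsto_lowerbound[OF dc_slope_tendsto[OF le0 xinf_sdom v] this] show ?thesis by simp
  qed
  have "((\<lambda>s. d + s *\<^sub>R e) \<longlongrightarrow> d) (at_right (0::real))" by (rule tendsto_ray)
  moreover have "\<forall>\<^sub>F s in at_right 0. 0 \<le> dc_slope P 0 j0 xinf (d + s *\<^sub>R e)"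
    using eventually_at_right_less[of 0] by eventually_elim (rule perturbed)
  ultimately show "0 \<le> dc_slope P 0 j0 xinf d"
    using tendsto_lowerbound[OF dc_slope_tendsto[OF le0 xinf_sdom]] by force
qed

text \<open>In the affine case the model of an active constraint does not depend on the base point and is
  positively homogeneous along a short segment, so a nonpositive slope makes it nonpositive
  there.\<close>

lemma affine_model_eventually_nonpos:
  assumes i: "i \<in> active_constraints P xinf" and j: "j \<in> active_pieces P i xinf"
    and phi: "affine_fun_on (sdom P) (phi P i)"
    and psi: "affine_fun_on (sdom P) (psi_piece P i j)"
    and zeta: "piecewise_affine_on (xset P) (zeta P i)"
    and d: "\<forall>\<^sub>F t in at_right 0. xinf + t *\<^sub>R d \<in> xset P"
    and le: "dc_slope P i j xinf d \<le> 0"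
  shows "\<forall>\<^sub>F t in at_right 0. \<forall>xb\<in>sdom P. dc_model P i j (xinf + t *\<^sub>R d) xb \<le> 0"
proof -
  have i1: "i \<in> {1..ncon P}" and i': "i \<le> ncon P" and zero: "dc_fun P i xinf = 0"
    using i by (auto simp: active_constraints_def)
  have lip: "lip P i = 0" using dc phi i1 by (auto simp: dc_assumptions_def)
  obtain a b where ab: "\<And>y. y \<in> sdom P \<Longrightarrow> phi P i y = a \<bullet> y + b"
    using phi by (auto simp: affine_fun_on_def)
  obtain a' b' where ab': "\<And>y. y \<in> sdom P \<Longrightarrow> psi_piece P i j y = a' \<bullet> y + b'"
    using psi by (auto simp: affine_fun_on_def)
  note grads = grad_affine[OF sdom_open _ ab] grad_affine[OF sdom_open _ ab']
  have model: "dc_model P i j y xb = a \<bullet> y + b + zeta P i y - (a' \<bullet> y + b')"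
    if "xb \<in> sdom P" for y xb
    using that by (simp add: dc_model_def phi_hat_def linearization_def lip grads ab ab' inner_diff_right)
  obtain c where c: "\<forall>\<^sub>F t in at_right 0. zeta P i (xinf + t *\<^sub>R d) = zeta P i xinf + t * c"
    using piecewise_affine_ray[OF zeta d] .
  have "has_dir_deriv (zeta P i) xinf d c"
    unfolding has_dir_deriv_def
  proof (rule tendsto_eventually)
    show "\<forall>\<^sub>F t in at_right 0. (zeta P i (xinf + t *\<^sub>R d) - zeta P i xinf) / t = c"
      using c eventually_at_right_less[of 0] by eventually_elim simp
  qed
  then have slope: "dc_slope P i j xinf d = a \<bullet> d + c - a' \<bullet> d"
    by (simp add: dc_slope_def dir_deriv_eqI grads xinf_sdom)
  have base: "a \<bullet> xinf + b + zeta P i xinf - (a' \<bullet> xinf + b') = 0"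
    using model[OF xinf_sdom, of xinf] dc_model_self[OF i' xinf_sdom j] zero by simp
  show ?thesis using c eventually_at_right_less[of 0]
  proof eventually_elim
    case (elim t)
    show ?case
    proof
      fix xb assume "xb \<in> sdom P"
      then have "dc_model P i j (xinf + t *\<^sub>R d) xb = t * dc_slope P i j xinf d"
        using base by (simp add: model elim slope inner_add_right algebra_simps)
      then show "dc_model P i j (xinf + t *\<^sub>R d) xb \<le> 0"
        using le elim by (simp add: mult_nonneg_nonpos)
    qed
  qed
qed

text \<open>A nonpositive model value leaves a penalty term of at most \<open>\<lambda>\<^sub>i\<^sup>2 / \<rho>\<close>. The exponent 2 is below
  \<open>1 + \<alpha>\<close> exactly when \<open>\<alpha> > 1\<close>.\<close>

lemma penalty_vanishes_if_models_nonpos: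
  assumes \<alpha>: "\<alpha> > 1" and i: "i \<in> {1..ncon P}" and le: "\<And>k. dc_model P i j y (x (r k)) \<le> 0"
  shows "(\<lambda>k. (max (l (r k) i + \<rho> (r k) * dc_model P i j y (x (r k))) 0)\<^sup>2 / \<rho> (r k)) \<longlonglongrightarrow> 0"
proof (rule Lim_null_comparison)
  show "(\<lambda>k. l (r k) i powr 2 / \<rho> (r k)) \<longlonglongrightarrow> 0"
    using \<alpha> by (intro multiplier_power_negligible i) auto
  have "norm ((max (l (r k) i + \<rho> (r k) * dc_model P i j y (x (r k))) 0)\<^sup>2 / \<rho> (r k))
      \<le> l (r k) i powr 2 / \<rho> (r k)" for k
  proof -
    have "\<rho> (r k) * dc_model P i j y (x (r k)) \<le> 0"
      using rho_pos[of "r k"] le[of k] by (simp add: mult_nonneg_nonpos)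
    then have "(max (l (r k) i + \<rho> (r k) * dc_model P i j y (x (r k))) 0)\<^sup>2 \<le> (l (r k) i)\<^sup>2"
      using l_nonneg[OF i, of "r k"] by (intro power_mono) auto
    then show ?thesis
      using rho_pos[of "r k"] l_nonneg[OF i, of "r k"]
      by (simp add: powr_numeral divide_right_mono)
  qed
  then show "\<forall>\<^sub>F k in sequentially.
      norm ((max (l (r k) i + \<rho> (r k) * dc_model P i j y (x (r k))) 0)\<^sup>2 / \<rho> (r k))
        \<le> l (r k) i powr 2 / \<rho> (r k)"
    by simp
qed

lemma limit_B_stationary_polyhedral:
  assumes \<alpha>: "\<alpha> > 1" and x: "xinf \<in> feasible_set P" and X: "polyhedron (xset P)"
    and aff: "\<And>i j. i \<in> active_constraints P xinf \<Longrightarrow> j \<in> active_pieces P i xinf \<Longrightarrow>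
      affine_fun_on (sdom P) (phi P i) \<and> affine_fun_on (sdom P) (psi_piece P i j) \<and>
      piecewise_affine_on (xset P) (zeta P i)"
  shows "B_stationary (objective P) (feasible_set P) xinf"
proof (rule B_stationaryI_slopes[OF x])
  fix d j0 j
  assume d: "d \<in> tangent_cone (feasible_set P) xinf"
    and j0: "j0 \<in> active_pieces P 0 xinf" and j: "j \<in> active_tuples P xinf"
    and le: "\<forall>i\<in>active_constraints P xinf. dc_slope P i (j i) xinf d \<le> 0"
  have "d \<in> tangent_cone (xset P) xinf"
    using d tangent_cone_mono[of "feasible_set P" "xset P"] by (auto simp: feasible_set_def)
  then have feas: "\<forall>\<^sub>F t in at_right 0. xinf + t *\<^sub>R d \<in> xset P"
    by (rule polyhedron_tangent_feasible[OF X xinf_in])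
  have "\<forall>\<^sub>F t in at_right 0. (\<forall>xb\<in>sdom P. dc_model P i (j i) (xinf + t *\<^sub>R d) xb \<le> 0)
      \<or> dc_model P i (j i) (xinf + t *\<^sub>R d) xinf < 0" if i: "i \<in> {1..ncon P}" for i
  proof (cases "i \<in> active_constraints P xinf")
    case True
    note a = aff[OF True active_tuple_piece[OF j i]]
    have "\<forall>\<^sub>F t in at_right 0. \<forall>xb\<in>sdom P. dc_model P i (j i) (xinf + t *\<^sub>R d) xb \<le> 0"
      using a le True
      by (intro affine_model_eventually_nonpos[OF True active_tuple_piece[OF j i] _ _ _ feas]) auto
    then show ?thesis by eventually_elim simp
  next
    case False
    show ?thesis
      using inactive_model_eventually_negative[OF x i False active_tuple_piece[OF j i], of d]
      by eventually_elim simp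
  qed
  then have "\<forall>\<^sub>F t in at_right 0. \<forall>i\<in>{1..ncon P}.
      (\<forall>xb\<in>sdom P. dc_model P i (j i) (xinf + t *\<^sub>R d) xb \<le> 0)
      \<or> dc_model P i (j i) (xinf + t *\<^sub>R d) xinf < 0"
    by (simp add: eventually_ball_finite)
  with feas have "\<forall>\<^sub>F t in at_right 0. objective P xinf \<le> dc_model P 0 j0 (xinf + t *\<^sub>R d) xinf"
  proof eventually_elim
    case (elim t)
    show ?case
    proof (rule limit_minimizes_objective_model[OF elim(1) j0 j])
      fix i assume i: "i \<in> {1..ncon P}"
      have "x (r k) \<in> sdom P" for k using x_in xset_subset by blast
      with elim(2) i show "(\<lambda>k. (max (l (r k) i + \<rho> (r k) *
          dc_model P i (j i) (xinf + t *\<^sub>R d) (x (r k))) 0)\<^sup>2 / \<rho> (r k)) \<longlonglongrightarrow> 0"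
        using penalty_vanishes_if_models_nonpos[OF \<alpha> i]
          penalty_vanishes_if_model_negative[OF i active_tuple_piece[OF j i]] by blast
    qed
  qed
  then show "0 \<le> dc_slope P 0 j0 xinf d" by (rule objective_slope_nonneg[OF j0])
qed

end

theorem theorem4p1:
  fixes P :: "(real ^ 'n) dc_program"
    and \<epsilon> \<alpha> \<sigma> :: real
    and \<eta> \<rho> :: "nat \<Rightarrow> real"
    and l :: "nat \<Rightarrow> nat \<Rightarrow> real"
    and x :: "nat \<Rightarrow> real ^ 'n"
    and xinf :: "real ^ 'n"
    and r :: "nat \<Rightarrow> nat"
  assumes "dc_assumptions P"
    and "alm_run P \<epsilon> \<alpha> \<sigma> \<eta> x l \<rho>"
    and "strict_mono r" and "(x \<circ> r) \<longlonglongrightarrow> xinf"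
  shows "D_stationary (\<lambda>y. \<Sum>i=1..ncon P. (max (dc_fun P i y) 0)\<^sup>2) (xset P) xinf
    \<and> (xinf \<in> feasible_set P \<and> active_constraints P xinf = {}
         \<longrightarrow> D_stationary (objective P) (xset P) xinf)
    \<and> (xinf \<in> feasible_set P \<and> active_constraints P xinf \<noteq> {} \<and> PSCQ P xinf
         \<longrightarrow> B_stationary (objective P) (feasible_set P) xinf)
    \<and> (\<alpha> > 1 \<and> xinf \<in> feasible_set P \<and> active_constraints P xinf \<noteq> {} \<and>
       polyhedron (xset P) \<and>
       (\<forall>i\<in>active_constraints P xinf. \<forall>j\<in>active_pieces P i xinf.
          affine_fun_on (sdom P) (phi P i) \<and> affine_fun_on (sdom P) (psi_piece P i j) \<and>
          piecewise_affine_on (xset P) (zeta P i))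
         \<longrightarrow> B_stationary (objective P) (feasible_set P) xinf)"
proof -
  interpret alm_limit P \<epsilon> \<alpha> \<sigma> \<eta> \<rho> l x xinf r
    using assms by unfold_locales
  show ?thesis
    using limit_D_stationary_infeasibility limit_D_stationary_objective limit_B_stationary_PSCQ
      limit_B_stationary_polyhedral
    by blast
qed

end
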